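(* Let $U\subset\mathbb C^k\times\mathbb C^l$ be open, and let $u=u_t$ be a smooth real-valued function on $U\times I$ ($I$ a time interval) such that $u_t\in\mathcal E^{k,l,\mathbb C}_U$ for all $t\in I$ and $$\frac{\partial u}{\partial t}=\log\det(u_{z_i\bar z_j})-\log\det(-u_{w_i\bar w_j}).$$ Let $$\mathcal L=u^{\bar z_bz_a}\frac{\partial^2}{\partial z_a\partial\bar z_b}-u^{\bar w_bw_a}\frac{\partial^2}{\partial w_a\partial\bar w_b}$$ and let $W$ be the Hermitian $(k+l)\times(k+l)$ matrix $$W=\begin{pmatrix}A-BD^{-1}B^*&BD^{-1}\\ D^{-1}B^*&-D^{-1}\end{pmatrix},\qquad A=(u_{z_i\bar z_j}),\quad B=(u_{z_i\bar w_j}),\quad D=(u_{w_i\bar w_j}).$$ Then $$\left(\frac{\partial}{\partial t}-\mathcal L\right)\frac{\partial u}{\partial t}=0,\qquad\left(\frac{\partial}{\partial t}-\mathcal L\right)W\le0.$$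
   Context: $(z_1,\dots,z_k,w_1,\dots,w_l)$ are coordinates on $\mathbb C^k\times\mathbb C^l$; subscripts denote partial derivatives. $\mathcal E^{k,l,\mathbb C}_U$ is the set of real-valued $u\in C^\infty(U)$ with $(u_{z_i\bar z_j})>0$ and $(u_{w_i\bar w_j})<0$ everywhere on $U$. $u^{\bar z_bz_a}$ denotes the entries of the inverse of the $k\times k$ block, so $u^{\bar z_bz_a}u_{z_a\bar z_c}=\delta_{bc}$, and similarly $u^{\bar w_bw_a}u_{w_a\bar w_c}=\delta_{bc}$ for the $l\times l$ block. Repeated indices are summed. $B^*$ is the conjugate transpose, with entries $u_{w_i\bar z_j}$. The operator $\frac{\partial}{\partial t}-\mathcal L$ acts on $W$ entrywise, and $\le0$ means that the resulting Hermitian matrix is negative semidefinite at every point. *)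

theory Defs
  imports "HOL-Analysis.Analysis"
begin

text \<open>
  \<open>C\<^sup>n\<close> functions via iterated directional derivatives.  The derivatives are taken within \<open>S\<close>, so
  that functions on \<open>I \<times> U\<close> can be treated when the interval \<open>I\<close> contains an endpoint.  This is the
  usual notion if the derivative within \<open>S\<close> is unique at every point of \<open>S\<close>, as it is when \<open>S\<close> is
  open, or \<open>S = I \<times> U\<close> with \<open>U\<close> open and \<open>I\<close> an interval with nonempty interior.
\<close>

fun Ck_on :: "nat \<Rightarrow> 'a::real_normed_vector set \<Rightarrow> ('a \<Rightarrow> 'b::real_normed_vector) \<Rightarrow> bool" where
  "Ck_on 0 S f \<longleftrightarrow> continuous_on S f"
| "Ck_on (Suc n) S f \<longleftrightarrow>
     (\<forall>x\<in>S. f differentiable (at x within S)) \<and>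
     (\<forall>v. Ck_on n S (\<lambda>x. frechet_derivative f (at x within S) v))"

definition smooth_on :: "'a::real_normed_vector set \<Rightarrow> ('a \<Rightarrow> 'b::real_normed_vector) \<Rightarrow> bool" where
  "smooth_on S f \<longleftrightarrow> (\<forall>n. Ck_on n S f)"

definition conj_transpose :: "complex^'n^'m \<Rightarrow> complex^'m^'n" where
  "conj_transpose M = (\<chi> i j. cnj (M $ j $ i))"

definition hermitian :: "complex^'n^'n \<Rightarrow> bool" where
  "hermitian M \<longleftrightarrow> conj_transpose M = M"

definition herm_form :: "complex^'n^'n \<Rightarrow> complex^'n \<Rightarrow> complex" where
  "herm_form M v = (\<Sum>i\<in>UNIV. \<Sum>j\<in>UNIV. cnj (v $ i) * M $ i $ j * v $ j)"

text \<open>The form of a Hermitian matrix takes real values, so \<^term>\<open>Re\<close> loses nothing here.\<close>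

definition pos_def :: "complex^'n^'n \<Rightarrow> bool" where
  "pos_def M \<longleftrightarrow> hermitian M \<and> (\<forall>v. v \<noteq> 0 \<longrightarrow> 0 < Re (herm_form M v))"

definition neg_def :: "complex^'n^'n \<Rightarrow> bool" where
  "neg_def M \<longleftrightarrow> hermitian M \<and> (\<forall>v. v \<noteq> 0 \<longrightarrow> Re (herm_form M v) < 0)"

definition neg_semidef :: "complex^'n^'n \<Rightarrow> bool" where
  "neg_semidef M \<longleftrightarrow> hermitian M \<and> (\<forall>v. Re (herm_form M v) \<le> 0)"

text \<open>
  Wirtinger derivatives \<open>\<partial>/\<partial>z\<^sub>a = (\<partial>/\<partial>x\<^sub>a - \<i> \<partial>/\<partial>y\<^sub>a) / 2\<close> and
  \<open>\<partial>/\<partial>\<zeta> = (\<partial>/\<partial>x\<^sub>a + \<i> \<partial>/\<partial>y\<^sub>a) / 2\<close> for \<open>\<zeta>\<close> the conjugate of \<open>z\<^sub>a = x\<^sub>a + \<i> y\<^sub>a\<close>; likewise in \<open>w\<close>.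
\<close>

definition dz :: "'k \<Rightarrow> ((complex^'k) \<times> (complex^'l) \<Rightarrow> complex)
    \<Rightarrow> (complex^'k) \<times> (complex^'l) \<Rightarrow> complex" where
  "dz a f p = (frechet_derivative f (at p) (axis a 1, 0)
               - \<i> * frechet_derivative f (at p) (axis a \<i>, 0)) / 2"

definition dzbar :: "'k \<Rightarrow> ((complex^'k) \<times> (complex^'l) \<Rightarrow> complex)
    \<Rightarrow> (complex^'k) \<times> (complex^'l) \<Rightarrow> complex" where
  "dzbar a f p = (frechet_derivative f (at p) (axis a 1, 0)
                  + \<i> * frechet_derivative f (at p) (axis a \<i>, 0)) / 2"

definition dw :: "'l \<Rightarrow> ((complex^'k) \<times> (complex^'l) \<Rightarrow> complex)
    \<Rightarrow> (complex^'k) \<times> (complex^'l) \<Rightarrow> complex" where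
  "dw a f p = (frechet_derivative f (at p) (0, axis a 1)
               - \<i> * frechet_derivative f (at p) (0, axis a \<i>)) / 2"

definition dwbar :: "'l \<Rightarrow> ((complex^'k) \<times> (complex^'l) \<Rightarrow> complex)
    \<Rightarrow> (complex^'k) \<times> (complex^'l) \<Rightarrow> complex" where
  "dwbar a f p = (frechet_derivative f (at p) (0, axis a 1)
                  + \<i> * frechet_derivative f (at p) (0, axis a \<i>)) / 2"

definition hess_zz :: "((complex^'k) \<times> (complex^'l) \<Rightarrow> real)
    \<Rightarrow> (complex^'k) \<times> (complex^'l) \<Rightarrow> complex^'k^'k" where
  "hess_zz u p = (\<chi> i j. dz i (dzbar j (\<lambda>q. complex_of_real (u q))) p)"

definition hess_zw :: "((complex^'k) \<times> (complex^'l) \<Rightarrow> real)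
    \<Rightarrow> (complex^'k) \<times> (complex^'l) \<Rightarrow> complex^'l^'k" where
  "hess_zw u p = (\<chi> i j. dz i (dwbar j (\<lambda>q. complex_of_real (u q))) p)"

definition hess_ww :: "((complex^'k) \<times> (complex^'l) \<Rightarrow> real)
    \<Rightarrow> (complex^'k) \<times> (complex^'l) \<Rightarrow> complex^'l^'l" where
  "hess_ww u p = (\<chi> i j. dw i (dwbar j (\<lambda>q. complex_of_real (u q))) p)"

definition E_class :: "((complex^'k) \<times> (complex^'l)) set
    \<Rightarrow> ((complex^'k) \<times> (complex^'l) \<Rightarrow> real) set" where
  "E_class U = {u. smooth_on U u \<and> (\<forall>p\<in>U. pos_def (hess_zz u p) \<and> neg_def (hess_ww u p))}"

definition block_matrix :: "complex^'k^'k \<Rightarrow> complex^'l^'k \<Rightarrow> complex^'k^'l \<Rightarrow> complex^'l^'l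
    \<Rightarrow> complex^('k + 'l)^('k + 'l)" where
  "block_matrix P Q R S = (\<chi> i j.
     case i of
       Inl a \<Rightarrow> (case j of Inl b \<Rightarrow> P $ a $ b | Inr b \<Rightarrow> Q $ a $ b)
     | Inr a \<Rightarrow> (case j of Inl b \<Rightarrow> R $ a $ b | Inr b \<Rightarrow> S $ a $ b))"

definition W_matrix :: "((complex^'k) \<times> (complex^'l) \<Rightarrow> real)
    \<Rightarrow> (complex^'k) \<times> (complex^'l) \<Rightarrow> complex^('k + 'l)^('k + 'l)" where
  "W_matrix u p =
     (let A = hess_zz u p; B = hess_zw u p; D' = matrix_inv (hess_ww u p)
      in block_matrix (A - B ** D' ** conj_transpose B) (B ** D')
                      (D' ** conj_transpose B)          (- D'))"

definition L_op :: "((complex^'k) \<times> (complex^'l) \<Rightarrow> real)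
    \<Rightarrow> ((complex^'k) \<times> (complex^'l) \<Rightarrow> complex) \<Rightarrow> (complex^'k) \<times> (complex^'l) \<Rightarrow> complex" where
  "L_op u f p =
     (\<Sum>a\<in>UNIV. \<Sum>b\<in>UNIV. matrix_inv (hess_zz u p) $ b $ a * dz a (dzbar b f) p)
   - (\<Sum>a\<in>UNIV. \<Sum>b\<in>UNIV. matrix_inv (hess_ww u p) $ b $ a * dw a (dwbar b f) p)"

text \<open>The time derivative is one-sided at an endpoint belonging to \<open>I\<close>.\<close>

definition dt :: "real set \<Rightarrow> (real \<Rightarrow> 'a \<Rightarrow> 'b::real_normed_vector) \<Rightarrow> real \<Rightarrow> 'a \<Rightarrow> 'b" where
  "dt I f t p = vector_derivative (\<lambda>s. f s p) (at t within I)"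

definition heat_op :: "real set \<Rightarrow> (real \<Rightarrow> (complex^'k) \<times> (complex^'l) \<Rightarrow> real)
    \<Rightarrow> (real \<Rightarrow> (complex^'k) \<times> (complex^'l) \<Rightarrow> complex)
    \<Rightarrow> real \<Rightarrow> (complex^'k) \<times> (complex^'l) \<Rightarrow> complex" where
  "heat_op I u f t p = dt I f t p - L_op (u t) (f t) p"

definition heat_op_matrix :: "real set \<Rightarrow> (real \<Rightarrow> (complex^'k) \<times> (complex^'l) \<Rightarrow> real)
    \<Rightarrow> (real \<Rightarrow> (complex^'k) \<times> (complex^'l) \<Rightarrow> complex^'n^'n)
    \<Rightarrow> real \<Rightarrow> (complex^'k) \<times> (complex^'l) \<Rightarrow> complex^'n^'n" where
  "heat_op_matrix I u M t p = (\<chi> i j. heat_op I u (\<lambda>s q. M s q $ i $ j) t p)"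

end

theory Submission imports Defs
begin

text \<open>
  Fix \<open>v = (\<xi>, \<eta>)\<close>.  The value of the form \<open>W\<close> at \<open>v\<close> is \<open>\<xi>\<^sup>* A \<xi> - y\<^sup>* D\<^sup>-\<^sup>1 y\<close> with
  \<open>y = B\<^sup>* \<xi> - \<eta>\<close>, so it suffices to apply the heat operator \<open>H = \<partial>/\<partial>t - \<L>\<close> to this function and
  to see that the result is real and not positive.  Differentiating \<open>D\<^sup>-\<^sup>1\<close> twice is avoided by
  freezing, at the point \<open>x\<^sub>0\<close> under consideration, the vector \<open>c = D\<^sup>-\<^sup>1 y\<close>.  Completing the square
  with this constant \<open>c\<close> gives, everywhere,
  \<open>v\<^sup>* W v = Z Z' u + (\<eta>\<^sup>* c + c\<^sup>* \<eta>) - r\<^sup>* D\<^sup>-\<^sup>1 r\<close>,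
  where \<open>Z = \<Sum> cnj \<xi>\<^sub>a \<partial>/\<partial>z\<^sub>a - \<Sum> cnj c\<^sub>b \<partial>/\<partial>w\<^sub>b\<close> has constant coefficients, \<open>Z'\<close> is its conjugate, and
  \<open>r = y - D c\<close> vanishes at \<open>x\<^sub>0\<close> (lemma \<open>W_form_square\<close>).

  The two nonconstant terms are now easy.  Since \<open>Z\<close> and \<open>Z'\<close> commute with all other derivatives, two
  differentiations of the flow equation give \<open>H (Z Z' u)\<close>: the linear part of the second derivative
  of \<open>log det\<close> is exactly \<open>\<L>\<close>, and the quadratic part remains.  With \<open>P = - D\<^sup>-\<^sup>1 > 0\<close> and
  \<open>\<tau>(M, N, T) = tr (M T N T\<^sup>*)\<close>, the function \<open>quad\<close> below, it reads
  \<open>H (Z Z' u) = - \<tau>(A\<^sup>-\<^sup>1, A\<^sup>-\<^sup>1, Z A) + \<tau>(P, P, Z D)\<close> (lemma \<open>Hop_levi\<close>).  As \<open>r\<close> vanishes at \<open>x\<^sub>0\<close>,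
  only first derivatives of \<open>r\<close> enter \<open>H (r\<^sup>* P r)\<close>, and the result is minus a sum of four terms
  \<open>\<tau>\<close> (lemma \<open>Hop_vanishing_form\<close>).  One of them is formed with the matrix
  \<open>\<partial>/\<partial>w\<^sub>a (cnj r\<^sub>b) = Z D\<^sub>a\<^sub>b\<close>, so it cancels the only term above that has the wrong sign.  Since
  \<open>\<tau>(M, N, T) \<ge> 0\<close> for positive definite \<open>M\<close> and \<open>N\<close> (lemma \<open>pos_def_contraction_nonneg\<close>), what is
  left is not positive.  The equation for \<open>\<partial>u/\<partial>t\<close> is the flow equation differentiated once.

  The analytic input is a calculus for functions on \<open>I \<times> U\<close> up to the ends of \<open>I\<close>: algebraic closure
  properties of smooth functions, the product rule, symmetry of second derivatives, and the
  derivatives of the inverse and of the logarithm of the determinant of a matrix.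
\<close>

section \<open>Positive definite Hermitian matrices\<close>

text \<open>
  Elimination of one index: subtracting the rank one matrix of the pivot \<open>m\<close> leaves a matrix that is
  again positive definite on the other indices, because its form at \<open>v\<close> is the original form at the
  vector that extends \<open>v\<close> by the coordinate minimising it.
\<close>
lemma cholesky_function:
  fixes P :: "'n \<Rightarrow> 'n \<Rightarrow> complex"
  assumes "finite S" "\<And>i j. P i j = cnj (P j i)"
    and "\<And>v. \<exists>i\<in>S. v i \<noteq> 0 \<Longrightarrow> 0 < Re (\<Sum>i\<in>S. \<Sum>j\<in>S. cnj (v i) * P i j * v j)"
  shows "\<exists>R. \<forall>i\<in>S. \<forall>j\<in>S. P i j = (\<Sum>m\<in>S. R i m * cnj (R j m))"
  using assms
proof (induction S arbitrary: P)
  case empty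
  show ?case by simp
next
  case (insert m S)
  note herm = insert.prems(1) and pos = insert.prems(2)
  define p where "p = Re (P m m)"
  have Pmm: "P m m = of_real p"
    using herm[of m m] by (simp add: p_def complex_eq_iff)
  have "0 < Re (\<Sum>i\<in>insert m S. \<Sum>j\<in>insert m S.
      cnj (if i = m then 1 else 0) * P i j * (if j = m then 1 else 0))"
    by (rule pos) auto
  also have "(\<Sum>i\<in>insert m S. \<Sum>j\<in>insert m S.
      cnj (if i = m then 1 else 0) * P i j * (if j = m then 1 else 0)) = P m m"
    using insert.hyps
    by (simp add: if_distrib[of cnj] if_distrib[of "\<lambda>x. x * _"] if_distrib[of "\<lambda>x. _ * x"] cong: if_cong)
  finally have p: "p > 0" by (simp add: p_def)
  define P' where "P' i j = P i j - P i m * P m j / of_real p" for i j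
  have "\<exists>R. \<forall>i\<in>S. \<forall>j\<in>S. P' i j = (\<Sum>n\<in>S. R i n * cnj (R j n))"
  proof (rule insert.IH)
    show "P' i j = cnj (P' j i)" for i j
      unfolding P'_def using herm[of i j] herm[of i m] herm[of m j] by simp
  next
    fix v :: "'n \<Rightarrow> complex"
    assume v: "\<exists>i\<in>S. v i \<noteq> 0"
    define s where "s = (\<Sum>j\<in>S. P m j * v j)"
    define F where "F = (\<Sum>i\<in>S. \<Sum>j\<in>S. cnj (v i) * P i j * v j)"
      \<comment> \<open>the coordinate at \<open>m\<close> that minimises the form for given values on \<open>S\<close>\<close>
    define w where "w = v(m := - s / of_real p)"
    have cs: "cnj s = (\<Sum>i\<in>S. cnj (v i) * P i m)"
      unfolding s_def cnj_sum using herm[of _ m] by (auto intro!: sum.cong simp: mult.commute)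
    have wS: "w j = v j" if "j \<in> S" for j using that insert.hyps by (auto simp: w_def)
    have wm: "w m = - s / of_real p" by (simp add: w_def)
    have "(\<Sum>i\<in>insert m S. \<Sum>j\<in>insert m S. cnj (w i) * P i j * w j)
        = cnj (w m) * P m m * w m + (\<Sum>j\<in>S. cnj (w m) * P m j * w j)
          + (\<Sum>i\<in>S. cnj (w i) * P i m * w m + (\<Sum>j\<in>S. cnj (w i) * P i j * w j))"
      using insert.hyps by simp
    also have "(\<Sum>j\<in>S. cnj (w m) * P m j * w j) = cnj (w m) * s"
      by (simp add: s_def sum_distrib_left wS mult.assoc)
    also have "(\<Sum>i\<in>S. cnj (w i) * P i m * w m + (\<Sum>j\<in>S. cnj (w i) * P i j * w j)) = cnj s * w m + F"
      by (simp add: sum.distrib F_def cs sum_distrib_right wS)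
    also have "cnj (w m) * P m m * w m + cnj (w m) * s + (cnj s * w m + F) = F - cnj s * s / of_real p"
      using p by (simp add: wm Pmm field_simps)
    also have "\<dots> = (\<Sum>i\<in>S. \<Sum>j\<in>S. cnj (v i) * P' i j * v j)"
    proof -
      have "cnj s * s / of_real p = (\<Sum>i\<in>S. \<Sum>j\<in>S. cnj (v i) * (P i m * P m j / of_real p) * v j)"
        unfolding cs unfolding s_def sum_product sum_divide_distrib by (simp add: ac_simps)
      then show ?thesis by (simp add: P'_def F_def algebra_simps sum_subtractf)
    qed
    finally have "(\<Sum>i\<in>insert m S. \<Sum>j\<in>insert m S. cnj (w i) * P i j * w j)
      = (\<Sum>i\<in>S. \<Sum>j\<in>S. cnj (v i) * P' i j * v j)" .
    moreover have "\<exists>i\<in>insert m S. w i \<noteq> 0" using v wS by fastforce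
    ultimately show "0 < Re (\<Sum>i\<in>S. \<Sum>j\<in>S. cnj (v i) * P' i j * v j)"
      using pos[of w] by simp
  qed
  then obtain R' where R': "\<And>i j. i \<in> S \<Longrightarrow> j \<in> S \<Longrightarrow> P' i j = (\<Sum>n\<in>S. R' i n * cnj (R' j n))"
    by blast
  \<comment> \<open>a factor of the remainder, bordered by the normalised pivot column\<close>
  define R where "R i n = (if n = m then P i m / of_real (sqrt p) else if i = m then 0 else R' i n)" for i n
  have sq: "complex_of_real (sqrt p) * complex_of_real (sqrt p) = of_real p"
    using p by (metis of_real_mult real_sqrt_mult_self abs_of_pos)
  have nm: "n \<noteq> m" if "n \<in> S" for n using that insert.hyps by auto
  have "P i j = (\<Sum>n\<in>insert m S. R i n * cnj (R j n))" if ij: "i \<in> insert m S" "j \<in> insert m S" for i j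
  proof -
    have Rm: "R i m * cnj (R j m) = P i m * P m j / of_real p"
      using herm[of m j] by (simp add: R_def sq)
    have "(\<Sum>n\<in>S. R i n * cnj (R j n)) = P i j - P i m * P m j / of_real p"
    proof (cases "i = m \<or> j = m")
      case True
      then show ?thesis using p nm by (auto simp: R_def Pmm)
    next
      case False
      then have "(\<Sum>n\<in>S. R i n * cnj (R j n)) = P' i j"
        using ij R' nm by (auto simp: R_def)
      then show ?thesis by (simp add: P'_def)
    qed
    then show ?thesis using insert.hyps Rm by simp
  qed
  then show ?case by blast
qed

lemma hermitianD:
  assumes "hermitian M"
  shows "cnj (M $ i $ j) = M $ j $ i"
proof -
  have "conj_transpose M $ j $ i = M $ j $ i" using assms by (simp add: hermitian_def)
  then show ?thesis by (simp add: conj_transpose_def)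
qed

lemma pos_defD_cnj: "pos_def M \<Longrightarrow> cnj (M $ i $ j) = M $ j $ i"
  unfolding pos_def_def by (blast intro: hermitianD)

lemma pos_def_cholesky:
  fixes M :: "complex^'n^'n"
  assumes "pos_def M"
  obtains R :: "complex^'n^'n" where "M = R ** conj_transpose R"
proof -
  have "\<exists>R. \<forall>i\<in>UNIV. \<forall>j\<in>UNIV. M $ i $ j = (\<Sum>m\<in>(UNIV::'n set). R i m * cnj (R j m))"
  proof (rule cholesky_function)
    show "M $ i $ j = cnj (M $ j $ i)" for i j
      by (rule pos_defD_cnj[OF assms, symmetric])
    show "0 < Re (\<Sum>i\<in>UNIV. \<Sum>j\<in>UNIV. cnj (v i) * M $ i $ j * v j)" if "\<exists>i\<in>UNIV. v i \<noteq> 0" for v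
    proof -
      have "(\<chi> i. v i) \<noteq> 0" using that by (auto simp: vec_eq_iff)
      then have "0 < Re (herm_form M (\<chi> i. v i))" using assms by (simp add: pos_def_def)
      then show ?thesis by (simp add: herm_form_def)
    qed
  qed simp
  then obtain R where R: "\<And>i j. M $ i $ j = (\<Sum>m\<in>(UNIV::'n set). R i m * cnj (R j m))" by blast
  have "M = (\<chi> i j. R i j) ** conj_transpose (\<chi> i j. R i j)"
    by (simp add: vec_eq_iff R matrix_matrix_mult_def conj_transpose_def)
  then show thesis by (rule that)
qed

lemma herm_form_mat_vec: "herm_form M v = (\<Sum>i\<in>UNIV. cnj (v $ i) * (M *v v) $ i)"
  by (simp add: herm_form_def matrix_vector_mult_def sum_distrib_left mult.assoc)

lemma invertible_pos_def:
  fixes M :: "complex^'n^'n"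
  assumes "pos_def M"
  shows "invertible M"
proof -
  have "v = 0" if "M *v v = 0" for v
  proof (rule ccontr)
    assume "v \<noteq> 0"
    then have "0 < Re (herm_form M v)" using assms by (simp add: pos_def_def)
    then show False by (simp add: herm_form_mat_vec that)
  qed
  then show ?thesis by (simp add: invertible_left_inverse matrix_left_invertible_ker)
qed

lemma matrix_inv_left: "invertible M \<Longrightarrow> matrix_inv M ** M = mat 1"
  and matrix_inv_right: "invertible M \<Longrightarrow> M ** matrix_inv M = mat 1"
  for M :: "complex^'n^'n"
  unfolding invertible_def matrix_inv_def by (metis (mono_tags, lifting) someI_ex)+

lemma matrix_inv_unique:
  fixes M :: "complex^'n^'n"
  assumes "M ** N = mat 1"
  shows "matrix_inv M = N"
proof -
  have "invertible M" using assms by (auto simp: invertible_right_inverse)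
  then have "matrix_inv M ** M = mat 1" by (rule matrix_inv_left)
  then show ?thesis using assms by (metis matrix_mul_assoc matrix_mul_lid matrix_mul_rid)
qed

lemma pos_def_matrix_inv:
  fixes M :: "complex^'n^'n"
  assumes M: "pos_def M"
  shows "pos_def (matrix_inv M)"
proof -
  let ?N = "matrix_inv M"
  note inv = matrix_inv_left[OF invertible_pos_def[OF M]] matrix_inv_right[OF invertible_pos_def[OF M]]
  have "conj_transpose (A ** B) = conj_transpose B ** conj_transpose A" for A B :: "complex^'n^'n"
    by (simp add: vec_eq_iff conj_transpose_def matrix_matrix_mult_def mult.commute)
  then have "conj_transpose M ** conj_transpose ?N = conj_transpose (mat 1)"
    by (metis inv(1))
  moreover have "conj_transpose (mat 1) = (mat 1 :: complex^'n^'n)"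
    by (simp add: vec_eq_iff conj_transpose_def mat_def)
  ultimately have "matrix_inv M = conj_transpose ?N"
    using M by (intro matrix_inv_unique) (simp add: pos_def_def hermitian_def)
  then have herm: "hermitian ?N" by (simp add: hermitian_def)
  have "0 < Re (herm_form ?N v)" if "v \<noteq> 0" for v
  proof -
    define y where "y = ?N *v v"
    have My: "M *v y = v" by (simp add: y_def matrix_vector_mul_assoc inv)
    then have "y \<noteq> 0" using that by auto
    then have "0 < Re (herm_form M y)" using M by (simp add: pos_def_def)
    moreover have "herm_form M y = cnj (herm_form ?N v)"
      by (simp add: herm_form_mat_vec My y_def[symmetric] mult.commute)
    ultimately show ?thesis by simp
  qed
  with herm show ?thesis by (simp add: pos_def_def)
qed

lemma pos_def_transpose:
  fixes M :: "complex^'n^'n"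
  assumes M: "pos_def M"
  shows "pos_def (transpose M)"
proof -
  have "herm_form (transpose M) v = herm_form M (\<chi> i. cnj (v $ i))" for v
    unfolding herm_form_def by (subst sum.swap) (simp add: transpose_def mult.commute mult.left_commute)
  moreover have "(\<chi> i. cnj (v $ i)) \<noteq> 0" if "v \<noteq> 0" for v :: "complex^'n"
    using that by (auto simp: vec_eq_iff)
  moreover have "hermitian (transpose M)"
    using pos_defD_cnj[OF M] by (simp add: hermitian_def conj_transpose_def transpose_def vec_eq_iff)
  ultimately show ?thesis using M by (simp add: pos_def_def)
qed

lemma det_conj_transpose: "det (conj_transpose M) = cnj (det M)"
  for M :: "complex^'n^'n"
proof -
  have "conj_transpose M = transpose (\<chi> i j. cnj (M $ i $ j))"
    by (simp add: vec_eq_iff conj_transpose_def transpose_def)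
  then have "det (conj_transpose M) = det (\<chi> i j. cnj (M $ i $ j))" by (simp add: det_transpose)
  also have "\<dots> = cnj (det M)" by (simp add: det_def)
  finally show ?thesis .
qed

text \<open>
  With a Cholesky factor \<open>R\<close>, the determinant is \<open>\<bar>det R\<bar>\<^sup>2\<close>.
\<close>
lemma det_pos_def:
  fixes M :: "complex^'n^'n"
  assumes M: "pos_def M"
  shows "det M = of_real (Re (det M))" "0 < Re (det M)"
proof -
  obtain R :: "complex^'n^'n" where "M = R ** conj_transpose R" using pos_def_cholesky[OF M] .
  then have d: "det M = of_real ((cmod (det R))\<^sup>2)"
    by (simp only: det_mul det_conj_transpose complex_norm_square)
  then show "det M = of_real (Re (det M))" by simp
  have "det M \<noteq> 0" using invertible_pos_def[OF M] by (simp add: invertible_det_nz)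
  with d show "0 < Re (det M)" by auto
qed

lemma sum_swap_pairs:
  "(\<Sum>c\<in>C. \<Sum>d\<in>D. \<Sum>a\<in>A. \<Sum>b\<in>B. f a b c d) = (\<Sum>a\<in>A. \<Sum>b\<in>B. \<Sum>c\<in>C. \<Sum>d\<in>D. f a b c d)"
proof -
  have "(\<Sum>c\<in>C. \<Sum>d\<in>D. \<Sum>a\<in>A. \<Sum>b\<in>B. f a b c d) = (\<Sum>c\<in>C. \<Sum>a\<in>A. \<Sum>b\<in>B. \<Sum>d\<in>D. f a b c d)"
    by (intro sum.cong refl, subst sum.swap) (intro sum.cong refl sum.swap)
  also have "\<dots> = (\<Sum>a\<in>A. \<Sum>b\<in>B. \<Sum>c\<in>C. \<Sum>d\<in>D. f a b c d)"
    by (subst sum.swap) (intro sum.cong refl sum.swap)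
  finally show ?thesis .
qed

text \<open>
  The sum is \<open>tr (P T Q T\<^sup>*)\<close>.  Factoring \<open>P = R R\<^sup>*\<close> turns it into a sum of values of the form
  \<open>Q\<close>, one for each column of \<open>R\<close>.
\<close>
lemma pos_def_contraction_nonneg:
  fixes P :: "complex^'k^'k" and Q :: "complex^'l^'l" and T :: "'k \<Rightarrow> 'l \<Rightarrow> complex"
  assumes P: "pos_def P" and Q: "pos_def Q"
  shows "(\<Sum>a\<in>UNIV. \<Sum>b\<in>UNIV. P $ b $ a *
            (\<Sum>c\<in>UNIV. \<Sum>d\<in>UNIV. Q $ c $ d * (T a c * cnj (T b d)))) \<in> \<real>\<^sub>\<ge>\<^sub>0"
proof -
  have sum_nonneg: "sum f X \<in> \<real>\<^sub>\<ge>\<^sub>0" if "\<And>x. x \<in> X \<Longrightarrow> f x \<in> \<real>\<^sub>\<ge>\<^sub>0" for f :: "'k \<Rightarrow> complex" and X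
    using that by (induction X rule: infinite_finite_induct) auto
  obtain R :: "complex^'k^'k" where R: "P = R ** conj_transpose R" using pos_def_cholesky[OF P] .
  define y where "y m = (\<chi> d. \<Sum>b\<in>UNIV. R $ b $ m * cnj (T b d))" for m
  have form: "herm_form Q v \<in> \<real>\<^sub>\<ge>\<^sub>0" for v
  proof -
    have "cnj (herm_form Q v) = herm_form Q v"
      unfolding herm_form_def cnj_sum
      by (subst sum.swap) (simp add: pos_defD_cnj[OF Q] mult.commute mult.left_commute)
    then have "Im (herm_form Q v) = 0" by (simp add: complex_eq_iff)
    moreover have "0 \<le> Re (herm_form Q v)"
      using Q by (cases "v = 0") (auto simp: pos_def_def herm_form_def less_imp_le)
    ultimately show ?thesis by (simp add: complex_nonneg_Reals_iff)
  qed
  have G: "herm_form Q (y m) = (\<Sum>a\<in>UNIV. \<Sum>b\<in>UNIV. R $ b $ m * cnj (R $ a $ m) *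
            (\<Sum>c\<in>UNIV. \<Sum>d\<in>UNIV. Q $ c $ d * (T a c * cnj (T b d))))" for m
  proof -
    have "herm_form Q (y m) = (\<Sum>c\<in>UNIV. \<Sum>d\<in>UNIV. \<Sum>a\<in>UNIV. \<Sum>b\<in>UNIV.
        R $ b $ m * cnj (R $ a $ m) * (Q $ c $ d * (T a c * cnj (T b d))))"
      unfolding herm_form_def y_def
      by (simp add: sum_distrib_left sum_distrib_right mult.assoc mult.left_commute mult.commute)
    also have "\<dots> = (\<Sum>a\<in>UNIV. \<Sum>b\<in>UNIV. \<Sum>c\<in>UNIV. \<Sum>d\<in>UNIV.
        R $ b $ m * cnj (R $ a $ m) * (Q $ c $ d * (T a c * cnj (T b d))))"
      by (rule sum_swap_pairs)
    finally show ?thesis by (simp add: sum_distrib_left)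
  qed
  have "(\<Sum>a\<in>UNIV. \<Sum>b\<in>UNIV. P $ b $ a *
            (\<Sum>c\<in>UNIV. \<Sum>d\<in>UNIV. Q $ c $ d * (T a c * cnj (T b d))))
      = (\<Sum>m\<in>UNIV. herm_form Q (y m))"
  proof -
    have "(\<Sum>m\<in>UNIV. herm_form Q (y m)) = (\<Sum>a\<in>UNIV. \<Sum>b\<in>UNIV. \<Sum>m\<in>UNIV. R $ b $ m * cnj (R $ a $ m) *
            (\<Sum>c\<in>UNIV. \<Sum>d\<in>UNIV. Q $ c $ d * (T a c * cnj (T b d))))"
      unfolding G by (subst sum.swap) (rule sum.cong[OF refl], rule sum.swap)
    then show ?thesis
      by (simp add: R matrix_matrix_mult_def conj_transpose_def sum_distrib_right)
  qed
  also have "\<dots> \<in> \<real>\<^sub>\<ge>\<^sub>0" by (rule sum_nonneg) (rule form)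
  finally show ?thesis .
qed

text \<open>
  By polarisation a matrix is Hermitian as soon as its form takes only real values, so the sign of
  the form settles both parts of negative semidefiniteness.
\<close>
lemma neg_semidefI:
  fixes M :: "complex^'n^'n"
  assumes form: "\<And>v. - herm_form M v \<in> \<real>\<^sub>\<ge>\<^sub>0"
  shows "neg_semidef M"
proof -
  have re: "Re (herm_form M v) \<le> 0" and im: "Im (herm_form M v) = 0" for v
    using form[of v] by (auto simp: complex_nonneg_Reals_iff)
  have pair: "herm_form M (axis i a + axis j b)
      = cnj a * M $ i $ i * a + cnj a * M $ i $ j * b + cnj b * M $ j $ i * a + cnj b * M $ j $ j * b"
    for i j a b
  proof -
    have col: "(M *v (axis i a + axis j b)) $ k = M $ k $ i * a + M $ k $ j * b" for k
      by (simp add: matrix_vector_mult_def axis_def algebra_simps sum.distrib if_distrib[of "\<lambda>x. _ * x"]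
          cong: if_cong)
    have row: "(\<Sum>k\<in>UNIV. cnj ((axis i a + axis j b) $ k) * g k) = cnj a * g i + cnj b * g j" for g
      by (simp add: axis_def algebra_simps sum.distrib if_distrib[of "\<lambda>x. _ * x"] if_distrib[of cnj]
          cong: if_cong)
    show ?thesis
      unfolding herm_form_mat_vec row col by (simp add: algebra_simps)
  qed
  have "cnj (M $ i $ j) = M $ j $ i" for i j
  proof -
    have d: "Im (M $ k $ k) = 0" for k
      using im[of "axis k 1 + axis k 0"] pair[of k 1 k 0] by simp
    have "Im (M $ i $ j) + Im (M $ j $ i) = 0"
      using im[of "axis i 1 + axis j 1"] d by (simp add: pair)
    moreover have "Re (M $ i $ j) - Re (M $ j $ i) = 0"
      using im[of "axis i 1 + axis j \<i>"] d by (simp add: pair)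
    ultimately show ?thesis by (simp add: complex_eq_iff)
  qed
  then have "hermitian M" by (simp add: hermitian_def conj_transpose_def vec_eq_iff)
  with re show ?thesis by (simp add: neg_semidef_def)
qed

lemma neg_def_uminus: "neg_def D \<Longrightarrow> pos_def (- D)"
  by (simp add: neg_def_def pos_def_def hermitian_def conj_transpose_def herm_form_def vec_eq_iff
      sum_negf)

lemma
  fixes M :: "complex^'n^'n"
  assumes "invertible (- M)"
  shows matrix_mul_inv_uminus: "M ** (- matrix_inv (- M)) = mat 1"
    and matrix_inv_uminus: "matrix_inv M = - matrix_inv (- M)"
proof -
  have "M ** (- matrix_inv (- M)) = (- M) ** matrix_inv (- M)"
    by (simp add: matrix_matrix_mult_def vec_eq_iff sum_negf)
  then show "M ** (- matrix_inv (- M)) = mat 1" by (simp add: matrix_inv_right[OF assms])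
  then show "matrix_inv M = - matrix_inv (- M)" by (rule matrix_inv_unique)
qed

section \<open>The form of W and completion of the square\<close>

definition cdot :: "complex^'n \<Rightarrow> complex^'n \<Rightarrow> complex" where
  "cdot a b = (\<Sum>i\<in>UNIV. cnj (a $ i) * b $ i)"

lemma cdot_diff_left: "cdot (a - b) c = cdot a c - cdot b c"
  and cdot_diff_right: "cdot a (b - c) = cdot a b - cdot a c"
  and cdot_minus_right: "cdot a (- b) = - cdot a b"
  by (simp_all add: cdot_def algebra_simps sum_subtractf sum_negf)

lemma cdot_mat_vec: "cdot a (M *v b) = cdot (conj_transpose M *v a) b"
proof -
  have "cdot a (M *v b) = (\<Sum>i\<in>UNIV. \<Sum>j\<in>UNIV. cnj (a $ i) * (M $ i $ j * b $ j))"
    by (simp add: cdot_def matrix_vector_mult_def sum_distrib_left)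
  also have "\<dots> = (\<Sum>j\<in>UNIV. \<Sum>i\<in>UNIV. cnj (a $ i) * (M $ i $ j * b $ j))"
    by (rule sum.swap)
  also have "\<dots> = cdot (conj_transpose M *v a) b"
    by (simp add: cdot_def matrix_vector_mult_def sum_distrib_left sum_distrib_right conj_transpose_def mult.commute mult.left_commute)
  finally show ?thesis .
qed

lemma sum_Inl_Inr: "(\<Sum>i\<in>(UNIV :: ('k::finite + 'l::finite) set). f i) = (\<Sum>i\<in>UNIV. f (Inl i)) + (\<Sum>i\<in>UNIV. f (Inr i))"
  unfolding UNIV_Plus_UNIV[symmetric] by (subst sum.Plus) simp_all

text \<open>
  The terms with \<open>D'\<close> in the four blocks combine to a single square, which is subtracted from the
  form of \<open>A\<close>.
\<close>
lemma block_matrix_form: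
  fixes A :: "complex^'k^'k" and B :: "complex^'l^'k" and D' :: "complex^'l^'l" and v :: "complex^('k + 'l)"
  defines "\<xi> \<equiv> \<chi> i. v $ Inl i" and "\<eta> \<equiv> \<chi> i. v $ Inr i"
  shows "herm_form (block_matrix (A - B ** D' ** conj_transpose B) (B ** D') (D' ** conj_transpose B) (- D')) v
    = cdot \<xi> (A *v \<xi>) - cdot (conj_transpose B *v \<xi> - \<eta>) (D' *v (conj_transpose B *v \<xi> - \<eta>))"
proof -
  have "herm_form (block_matrix P Q R S) v
      = cdot \<xi> (P *v \<xi>) + cdot \<xi> (Q *v \<eta>) + cdot \<eta> (R *v \<xi>) + cdot \<eta> (S *v \<eta>)"
    for P :: "complex^'k^'k" and Q R S
    unfolding herm_form_def cdot_def matrix_vector_mult_def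
    by (simp add: sum_Inl_Inr block_matrix_def \<xi>_def \<eta>_def sum.distrib sum_distrib_left mult.assoc)
  moreover have "(- D') *v w = - (D' *v w)" for w
    by (simp add: matrix_vector_mult_def vec_eq_iff sum_negf)
  ultimately show ?thesis
    by (simp add: matrix_vector_mult_diff_rdistrib cdot_diff_right cdot_diff_left matrix_vector_mul_assoc[symmetric]
        matrix_vector_mult_diff_distrib cdot_mat_vec[of \<xi> B] cdot_minus_right)
qed

text \<open>
  For \<open>c = D' y\<close> the last square vanishes; if \<open>y\<close>, \<open>D\<close> and \<open>D'\<close> vary
  and \<open>c\<close> is kept at its value for one point, the last square vanishes to second order there, while
  the other terms are affine in \<open>y\<close> and \<open>D\<close>.
\<close>
lemma complete_square:
  fixes D D' :: "complex^'l^'l"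
  assumes D: "hermitian D" and inv: "D ** D' = mat 1"
  shows "cdot y (D' *v y) = cdot y c + cdot c y - cdot c (D *v c) + cdot (y - D *v c) (D' *v (y - D *v c))"
proof -
  have inv': "D' ** D = mat 1" using inv matrix_left_right_inverse by blast
  have "D' *v (D *v c) = c" by (simp add: matrix_vector_mul_assoc inv')
  moreover have "cdot (D *v c) z = cdot c (D *v z)" for z
    using cdot_mat_vec[of c D z] D by (simp add: hermitian_def)
  moreover have "D *v (D' *v y) = y" by (simp add: matrix_vector_mul_assoc inv)
  ultimately show ?thesis
    by (simp add: matrix_vector_mult_diff_distrib cdot_diff_left cdot_diff_right)
qed

section \<open>Smooth functions on a set with boundary\<close>

text \<open>
  The first condition makes the derivative within \<open>S\<close> unique, so that the usual rules hold for it; the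
  second one carries the symmetry of second derivatives from the interior of \<open>S\<close> to all of \<open>S\<close>.  For
  \<open>S = I \<times> U\<close> they allow one-sided time derivatives at the ends of \<open>I\<close>.
\<close>
locale regular_domain =
  fixes S :: "'v::euclidean_space set"
  assumes accessible:
      "\<And>x i e. x \<in> S \<Longrightarrow> i \<in> Basis \<Longrightarrow> e > 0 \<Longrightarrow> \<exists>d. 0 < \<bar>d\<bar> \<and> \<bar>d\<bar> < e \<and> x + d *\<^sub>R i \<in> S"
    and interior_dense: "S \<subseteq> closure (interior S)"
begin

definition pd :: "'v \<Rightarrow> ('v \<Rightarrow> 'b::real_normed_vector) \<Rightarrow> 'v \<Rightarrow> 'b" where
  "pd v f x = frechet_derivative f (at x within S) v"

lemma pd_eqI:
  assumes "(f has_derivative f') (at x within S)" "x \<in> S"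
  shows "pd v f x = f' v"
proof -
  have "(f has_derivative frechet_derivative f (at x within S)) (at x within S)"
    using assms frechet_derivative_works differentiableI by blast
  then have "frechet_derivative f (at x within S) = f'"
    using frechet_derivative_unique_within[OF _ assms(1)] accessible[OF assms(2)] by blast
  then show ?thesis by (simp add: pd_def)
qed

lemma has_derivative_within_cong_on:
  assumes "\<And>x. x \<in> S \<Longrightarrow> f x = g x" "x \<in> S"
  shows "(f has_derivative h) (at x within S) \<longleftrightarrow> (g has_derivative h) (at x within S)"
proof
  assume "(f has_derivative h) (at x within S)"
  then show "(g has_derivative h) (at x within S)"
    by (rule has_derivative_transform[OF assms(2), rotated]) (simp add: assms)
next
  assume "(g has_derivative h) (at x within S)"
  then show "(f has_derivative h) (at x within S)"
    by (rule has_derivative_transform[OF assms(2), rotated]) (simp add: assms)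
qed

lemma Ck_on_cong:
  assumes "\<And>x. x \<in> S \<Longrightarrow> f x = g x"
  shows "Ck_on n S f \<longleftrightarrow> Ck_on n S g"
  using assms
proof (induction n arbitrary: f g)
  case 0
  then show ?case using continuous_on_cong[OF refl, of S f g] by auto
next
  case (Suc n)
  have hd: "(f has_derivative h) (at x within S) \<longleftrightarrow> (g has_derivative h) (at x within S)"
    if "x \<in> S" for x h
    by (rule has_derivative_within_cong_on) (simp_all add: Suc.prems that)
  have d: "f differentiable (at x within S) \<longleftrightarrow> g differentiable (at x within S)" if "x \<in> S" for x
    using hd[OF that] by (simp add: differentiable_def)
  have "frechet_derivative f (at x within S) v = frechet_derivative g (at x within S) v"
    if "x \<in> S" for x v
    using hd[OF that] by (simp add: frechet_derivative_def)
  then have "Ck_on n S (\<lambda>x. frechet_derivative f (at x within S) v)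
      \<longleftrightarrow> Ck_on n S (\<lambda>x. frechet_derivative g (at x within S) v)" for v
    by (intro Suc.IH)
  with d show ?case by simp
qed

lemma smooth_on_cong:
  assumes "smooth_on S f" "\<And>x. x \<in> S \<Longrightarrow> g x = f x"
  shows "smooth_on S g"
  using assms Ck_on_cong[of g f] by (simp add: smooth_on_def)

lemma pd_cong:
  assumes "\<And>x. x \<in> S \<Longrightarrow> f x = g x" "x \<in> S"
  shows "pd v f x = pd v g x"
proof -
  have "(f has_derivative h) (at x within S) \<longleftrightarrow> (g has_derivative h) (at x within S)" for h
    by (rule has_derivative_within_cong_on) (simp_all add: assms)
  then show ?thesis by (simp add: pd_def frechet_derivative_def)
qed

lemma Ck_on_Suc_iff:
  "Ck_on (Suc n) S f \<longleftrightarrow>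
     (\<forall>x\<in>S. (f has_derivative (\<lambda>v. pd v f x)) (at x within S)) \<and> (\<forall>v. Ck_on n S (pd v f))"
proof -
  have "(\<lambda>v. pd v f x) = frechet_derivative f (at x within S)" for x
    by (simp add: pd_def)
  moreover have "pd v f = (\<lambda>x. frechet_derivative f (at x within S) v)" for v
    by (simp add: pd_def fun_eq_iff)
  ultimately show ?thesis by (simp add: frechet_derivative_works)
qed

text \<open>
  This is how a concrete derivative enters the recursive notion of \<open>C\<^sup>n\<close>: each rule of differentiation
  then yields the corresponding closure property by induction on \<open>n\<close>.
\<close>
lemma Ck_on_SucI:
  assumes "\<And>x. x \<in> S \<Longrightarrow> (f has_derivative (\<lambda>v. f' v x)) (at x within S)"
    and "\<And>v. Ck_on n S (f' v)"
  shows "Ck_on (Suc n) S f"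
proof -
  have eq: "pd v f x = f' v x" if "x \<in> S" for v x
    using pd_eqI[OF assms(1)[OF that] that] .
  then have "Ck_on n S (pd v f)" for v
    using Ck_on_cong[of "pd v f" "f' v"] assms(2) by simp
  moreover have "(f has_derivative (\<lambda>v. pd v f x)) (at x within S)" if "x \<in> S" for x
    using assms(1)[OF that] eq[OF that] by simp
  ultimately show ?thesis by (simp add: Ck_on_Suc_iff del: Ck_on.simps)
qed

lemma Ck_on_Suc_imp: "Ck_on (Suc n) S f \<Longrightarrow> Ck_on n S f"
proof (induction n arbitrary: f)
  case 0
  then show ?case
    by (auto simp: continuous_on_eq_continuous_within intro: differentiable_imp_continuous_within)
next
  case (Suc n)
  then show ?case by (simp add: Ck_on_Suc_iff del: Ck_on.simps)
qed

lemma smooth_has_derivative: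
  assumes "smooth_on S f" "x \<in> S"
  shows "(f has_derivative (\<lambda>v. pd v f x)) (at x within S)"
proof -
  have "Ck_on (Suc 0) S f" using assms by (simp only: smooth_on_def)
  then show ?thesis using assms(2) by (simp add: Ck_on_Suc_iff del: Ck_on.simps)
qed

lemma smooth_pd: "smooth_on S f \<Longrightarrow> smooth_on S (pd v f)"
  unfolding smooth_on_def using Ck_on_Suc_iff by blast

lemma smooth_continuous: "smooth_on S f \<Longrightarrow> continuous_on S f"
  unfolding smooth_on_def by (metis Ck_on.simps(1))

lemma Ck_on_const: "Ck_on n S (\<lambda>x. c)"
proof (induction n arbitrary: c)
  case (Suc n)
  show ?case by (rule Ck_on_SucI[where f' = "\<lambda>v x. 0"]) (auto intro: Suc)
qed auto

lemma Ck_on_bounded_linear: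
  assumes "bounded_linear h"
  shows "Ck_on n S f \<Longrightarrow> Ck_on n S (\<lambda>x. h (f x))"
proof (induction n arbitrary: f)
  case 0
  then show ?case
    using bounded_linear.continuous_on[OF assms] by auto
next
  case (Suc n)
  show ?case
    by (rule Ck_on_SucI[where f' = "\<lambda>v x. h (pd v f x)"])
      (use Suc in \<open>auto simp: Ck_on_Suc_iff simp del: Ck_on.simps
        intro: bounded_linear.has_derivative[OF assms]\<close>)
qed

lemma Ck_on_add: "Ck_on n S f \<Longrightarrow> Ck_on n S g \<Longrightarrow> Ck_on n S (\<lambda>x. f x + g x)"
proof (induction n arbitrary: f g)
  case 0
  then show ?case by (auto intro: continuous_intros)
next
  case (Suc n)
  show ?case
    by (rule Ck_on_SucI[where f' = "\<lambda>v x. pd v f x + pd v g x"])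
      (use Suc in \<open>auto simp: Ck_on_Suc_iff simp del: Ck_on.simps intro: has_derivative_add\<close>)
qed

lemma Ck_on_mult:
  fixes f g :: "'v \<Rightarrow> complex"
  shows "Ck_on n S f \<Longrightarrow> Ck_on n S g \<Longrightarrow> Ck_on n S (\<lambda>x. f x * g x)"
proof (induction n arbitrary: f g)
  case 0
  then show ?case by (auto intro: continuous_intros)
next
  case (Suc n)
  show ?case
  proof (rule Ck_on_SucI[where f' = "\<lambda>v x. f x * pd v g x + pd v f x * g x"])
    show "((\<lambda>x. f x * g x) has_derivative (\<lambda>v. f x * pd v g x + pd v f x * g x)) (at x within S)"
      if "x \<in> S" for x
      using Suc.prems that by (auto simp: Ck_on_Suc_iff simp del: Ck_on.simps intro: has_derivative_mult)
    show "Ck_on n S (\<lambda>x. f x * pd v g x + pd v f x * g x)" for v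
      using Suc.prems Suc.prems[THEN Ck_on_Suc_imp]
      by (auto simp: Ck_on_Suc_iff simp del: Ck_on.simps intro!: Ck_on_add Suc.IH)
  qed
qed

lemma Ck_on_inverse:
  fixes f :: "'v \<Rightarrow> complex"
  assumes "\<And>x. x \<in> S \<Longrightarrow> f x \<noteq> 0"
  shows "Ck_on n S f \<Longrightarrow> Ck_on n S (\<lambda>x. inverse (f x))"
proof (induction n)
  case 0
  then show ?case using assms by (auto intro: continuous_intros)
next
  case (Suc n)
  show ?case
  proof (rule Ck_on_SucI[where f' = "\<lambda>v x. (- 1) * (inverse (f x) * pd v f x * inverse (f x))"])
    show "((\<lambda>x. inverse (f x)) has_derivative
        (\<lambda>v. (- 1) * (inverse (f x) * pd v f x * inverse (f x)))) (at x within S)"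
      if "x \<in> S" for x
      using Suc.prems that Deriv.has_derivative_inverse[where f = f, OF assms[OF that]]
      by (auto simp: Ck_on_Suc_iff simp del: Ck_on.simps)
    show "Ck_on n S (\<lambda>x. (- 1) * (inverse (f x) * pd v f x * inverse (f x)))" for v
      using Suc.prems Suc.IH Suc.prems[THEN Ck_on_Suc_imp]
      by (intro Ck_on_mult Ck_on_const) (auto simp: Ck_on_Suc_iff simp del: Ck_on.simps)
  qed
qed

lemma smooth_const [intro]: "smooth_on S (\<lambda>x. c)"
  by (simp add: smooth_on_def Ck_on_const)
lemma smooth_add [intro]: "smooth_on S f \<Longrightarrow> smooth_on S g \<Longrightarrow> smooth_on S (\<lambda>x. f x + g x)"
  by (simp add: smooth_on_def Ck_on_add)
lemma smooth_mult [intro]: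
  fixes f g :: "'v \<Rightarrow> complex"
  shows "smooth_on S f \<Longrightarrow> smooth_on S g \<Longrightarrow> smooth_on S (\<lambda>x. f x * g x)"
  by (simp add: smooth_on_def Ck_on_mult)
lemma smooth_inverse:
  fixes f :: "'v \<Rightarrow> complex"
  shows "smooth_on S f \<Longrightarrow> (\<And>x. x \<in> S \<Longrightarrow> f x \<noteq> 0) \<Longrightarrow> smooth_on S (\<lambda>x. inverse (f x))"
  by (simp add: smooth_on_def Ck_on_inverse)
lemma smooth_bounded_linear:
  "bounded_linear h \<Longrightarrow> smooth_on S f \<Longrightarrow> smooth_on S (\<lambda>x. h (f x))"
  by (simp add: smooth_on_def Ck_on_bounded_linear)
lemma smooth_minus [intro]:
  "smooth_on S f \<Longrightarrow> smooth_on S (\<lambda>x. - f x)"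
  by (rule smooth_bounded_linear) (rule bounded_linear_minus[OF bounded_linear_ident])
lemma smooth_diff [intro]:
  "smooth_on S f \<Longrightarrow> smooth_on S g \<Longrightarrow> smooth_on S (\<lambda>x. f x - g x)"
  using smooth_add[OF _ smooth_minus, of f g] by simp
lemma smooth_cnj [intro]: "smooth_on S f \<Longrightarrow> smooth_on S (\<lambda>x. cnj (f x))"
  by (rule smooth_bounded_linear) (rule bounded_linear_cnj)
lemma smooth_sum [intro]:
  "(\<And>i. i \<in> X \<Longrightarrow> smooth_on S (f i)) \<Longrightarrow> smooth_on S (\<lambda>x. \<Sum>i\<in>X. f i x)"
  by (induction X rule: infinite_finite_induct) auto
lemma smooth_prod [intro]:
  fixes f :: "'i \<Rightarrow> 'v \<Rightarrow> complex"
  shows "(\<And>i. i \<in> X \<Longrightarrow> smooth_on S (f i)) \<Longrightarrow> smooth_on S (\<lambda>x. \<Prod>i\<in>X. f i x)"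
  by (induction X rule: infinite_finite_induct) auto

lemma pd_add:
  "smooth_on S f \<Longrightarrow> smooth_on S g \<Longrightarrow> x \<in> S \<Longrightarrow> pd v (\<lambda>x. f x + g x) x = pd v f x + pd v g x"
  by (rule pd_eqI) (auto intro!: has_derivative_add smooth_has_derivative)
lemma pd_mult:
  fixes f g :: "'v \<Rightarrow> complex"
  shows "smooth_on S f \<Longrightarrow> smooth_on S g \<Longrightarrow> x \<in> S
    \<Longrightarrow> pd v (\<lambda>x. f x * g x) x = f x * pd v g x + pd v f x * g x"
  by (rule pd_eqI) (auto intro!: has_derivative_mult smooth_has_derivative)
lemma pd_bounded_linear:
  "bounded_linear h \<Longrightarrow> smooth_on S f \<Longrightarrow> x \<in> S \<Longrightarrow> pd v (\<lambda>x. h (f x)) x = h (pd v f x)"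
  by (rule pd_eqI[OF bounded_linear.has_derivative[OF _ smooth_has_derivative]])
lemma pd_const: "x \<in> S \<Longrightarrow> pd v (\<lambda>x. c) x = 0"
  by (rule pd_eqI) auto

lemma linear_pd: "smooth_on S f \<Longrightarrow> x \<in> S \<Longrightarrow> linear (\<lambda>v. pd v f x)"
  using smooth_has_derivative has_derivative_linear by blast

lemma line_has_derivative:
  fixes f :: "'v \<Rightarrow> real"
  assumes f: "smooth_on S f" and x: "x + s *\<^sub>R v \<in> interior S"
  shows "((\<lambda>s. f (x + s *\<^sub>R v)) has_real_derivative pd v f (x + s *\<^sub>R v)) (at s)"
proof -
  let ?y = "x + s *\<^sub>R v"
  have yS: "?y \<in> S" using x interior_subset by blast
  have "(f has_derivative (\<lambda>v. pd v f ?y)) (at ?y)"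
    using smooth_has_derivative[OF f yS] at_within_interior[OF x] by simp
  moreover have "((\<lambda>s. x + s *\<^sub>R v) has_derivative (\<lambda>h. h *\<^sub>R v)) (at s)"
    by (auto intro!: derivative_eq_intros)
  ultimately have "((\<lambda>s. f (x + s *\<^sub>R v)) has_derivative (\<lambda>h. pd (h *\<^sub>R v) f ?y)) (at s)"
    using has_derivative_compose[of "\<lambda>s. x + s *\<^sub>R v" _ s UNIV f] by blast
  moreover have "pd (h *\<^sub>R v) f ?y = pd v f ?y * h" for h
    using linear_scale[OF linear_pd[OF f yS]] by simp
  ultimately show ?thesis by (simp add: has_field_derivative_def)
qed

text \<open>
  The second difference is symmetric in \<open>v\<close> and \<open>w\<close>, and by two applications of the mean value
  theorem it is \<open>h\<^sup>2\<close> times a value of either mixed derivative on the small parallelogram.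
\<close>
lemma second_difference_mean_value:
  fixes f :: "'v \<Rightarrow> real"
  assumes f: "smooth_on S f" and h: "h > 0"
    and box: "\<And>s r. 0 \<le> s \<Longrightarrow> s \<le> h \<Longrightarrow> 0 \<le> r \<Longrightarrow> r \<le> h \<Longrightarrow> x + s *\<^sub>R v + r *\<^sub>R w \<in> interior S"
  obtains s r where "0 < s" "s < h" "0 < r" "r < h"
    "f (x + h *\<^sub>R v + h *\<^sub>R w) - f (x + h *\<^sub>R v) - f (x + h *\<^sub>R w) + f x
       = h * (h * pd w (pd v f) (x + s *\<^sub>R v + r *\<^sub>R w))"
proof -
  define g where "g s = f (x + h *\<^sub>R w + s *\<^sub>R v) - f (x + s *\<^sub>R v)" for s
  define g' where "g' s = pd v f (x + h *\<^sub>R w + s *\<^sub>R v) - pd v f (x + s *\<^sub>R v)" for s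
  have "(g has_real_derivative g' s) (at s)" if "0 \<le> s" "s \<le> h" for s
    unfolding g_def g'_def
    using box[OF that, of h] box[OF that, of 0] h
    by (intro DERIV_diff line_has_derivative f) (auto simp: algebra_simps)
  then obtain s where s: "0 < s" "s < h" "g h - g 0 = h * g' s"
    using MVT2[of 0 h g g'] h by auto
  let ?y = "x + s *\<^sub>R v"
  have "((\<lambda>r. pd v f (?y + r *\<^sub>R w)) has_real_derivative pd w (pd v f) (?y + r *\<^sub>R w)) (at r)"
    if "0 \<le> r" "r \<le> h" for r
    using box[of s r] s that by (intro line_has_derivative smooth_pd f) auto
  then obtain r where r: "0 < r" "r < h"
      "pd v f (?y + h *\<^sub>R w) - pd v f (?y + 0 *\<^sub>R w) = h * pd w (pd v f) (?y + r *\<^sub>R w)"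
    using MVT2[of 0 h "\<lambda>r. pd v f (?y + r *\<^sub>R w)"
        "\<lambda>r. pd w (pd v f) (?y + r *\<^sub>R w)"] h by auto
  have "g h - g 0 = h * (h * pd w (pd v f) (?y + r *\<^sub>R w))"
    using s(3) r(3) by (simp add: g'_def algebra_simps)
  with s r that show thesis by (simp add: g_def algebra_simps)
qed

lemma pd_commute_interior:
  fixes f :: "'v \<Rightarrow> real"
  assumes f: "smooth_on S f" and x: "x \<in> interior S"
  shows "pd v (pd w f) x = pd w (pd v f) x"
proof -
  obtain e where e: "e > 0" "ball x e \<subseteq> interior S"
    using x open_contains_ball open_interior by blast
  \<comment> \<open>parallelograms of side at most \<open>k\<close> stay in the ball\<close>
  define k where "k = e / (norm v + norm w + 1)"
  have k: "k > 0" using e by (simp add: k_def add_nonneg_pos)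
  have near: "norm (s *\<^sub>R v + r *\<^sub>R w) < e" if "0 \<le> s" "s \<le> h" "0 \<le> r" "r \<le> h" "h \<le> k" for s r h
  proof -
    have "norm (s *\<^sub>R v + r *\<^sub>R w) \<le> s * norm v + r * norm w"
      using norm_triangle_ineq[of "s *\<^sub>R v" "r *\<^sub>R w"] that by simp
    also have "\<dots> \<le> k * norm v + k * norm w"
      using that by (intro add_mono mult_right_mono) auto
    also have "\<dots> < k * (norm v + norm w + 1)" using k by (simp add: algebra_simps)
    also have "\<dots> = e" by (simp add: k_def add_nonneg_pos less_imp_neq[symmetric])
    finally show ?thesis .
  qed
  have inS: "x + s *\<^sub>R v + r *\<^sub>R w \<in> interior S"
    if "0 \<le> s" "s \<le> h" "0 \<le> r" "r \<le> h" "h \<le> k" for s r h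
  proof -
    have "dist x (x + (s *\<^sub>R v + r *\<^sub>R w)) = norm (s *\<^sub>R v + r *\<^sub>R w)"
      by (metis add_diff_cancel_left' dist_commute dist_norm)
    with near[OF that] have "x + (s *\<^sub>R v + r *\<^sub>R w) \<in> ball x e" by simp
    then show ?thesis using e(2) by (auto simp: add.assoc)
  qed
  define hh where "hh n = k / (real n + 1)" for n
  have hh: "0 < hh n" "hh n \<le> k" for n
    using k by (auto simp: hh_def field_simps)
  have "\<exists>s r s' r'. 0 < s \<and> s < hh n \<and> 0 < r \<and> r < hh n \<and> 0 < s' \<and> s' < hh n \<and> 0 < r' \<and> r' < hh n \<and>
      pd w (pd v f) (x + s *\<^sub>R v + r *\<^sub>R w) = pd v (pd w f) (x + s' *\<^sub>R v + r' *\<^sub>R w)" for n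
  proof -
    obtain s r where 1: "0 < s" "s < hh n" "0 < r" "r < hh n"
      "f (x + hh n *\<^sub>R v + hh n *\<^sub>R w) - f (x + hh n *\<^sub>R v) - f (x + hh n *\<^sub>R w) + f x
         = hh n * (hh n * pd w (pd v f) (x + s *\<^sub>R v + r *\<^sub>R w))"
      using second_difference_mean_value[OF f hh(1)[of n], of x v w] inS hh(2) by blast
    have "x + s *\<^sub>R w + r *\<^sub>R v \<in> interior S"
      if "0 \<le> s" "s \<le> hh n" "0 \<le> r" "r \<le> hh n" for s r
      using inS[of r "hh n" s] that hh(2)[of n] by (simp add: add.assoc add.commute[of "s *\<^sub>R w"])
    then obtain r' s' where 2: "0 < r'" "r' < hh n" "0 < s'" "s' < hh n"
      "f (x + hh n *\<^sub>R w + hh n *\<^sub>R v) - f (x + hh n *\<^sub>R w) - f (x + hh n *\<^sub>R v) + f x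
         = hh n * (hh n * pd v (pd w f) (x + r' *\<^sub>R w + s' *\<^sub>R v))"
      using second_difference_mean_value[OF f hh(1)[of n], of x w v] by blast
    have "hh n * (hh n * pd w (pd v f) (x + s *\<^sub>R v + r *\<^sub>R w))
        = hh n * (hh n * pd v (pd w f) (x + s' *\<^sub>R v + r' *\<^sub>R w))"
      using 1(5) 2(5) by (simp add: algebra_simps)
    then have "pd w (pd v f) (x + s *\<^sub>R v + r *\<^sub>R w) = pd v (pd w f) (x + s' *\<^sub>R v + r' *\<^sub>R w)"
      using hh(1)[of n] by simp
    then show ?thesis using 1 2 by blast
  qed
  then obtain s r s' r' where
    b: "\<And>n. 0 < s n \<and> s n < hh n \<and> 0 < r n \<and> r n < hh n \<and>
       0 < s' n \<and> s' n < hh n \<and> 0 < r' n \<and> r' n < hh n"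
    and eq: "\<And>n. pd w (pd v f) (x + s n *\<^sub>R v + r n *\<^sub>R w)
       = pd v (pd w f) (x + s' n *\<^sub>R v + r' n *\<^sub>R w)"
    by metis
  have hh0: "hh \<longlonglongrightarrow> 0"
  proof -
    have "(\<lambda>n. k * (1 / real (Suc n))) \<longlonglongrightarrow> k * 0"
      by (intro tendsto_mult tendsto_const LIMSEQ_Suc[OF lim_1_over_n])
    then show ?thesis by (simp add: hh_def[abs_def] add.commute)
  qed
  have lim0: "t \<longlonglongrightarrow> 0" if "\<And>n. 0 < t n \<and> t n < hh n" for t
    by (rule tendsto_sandwich[OF _ _ tendsto_const hh0]) (use that in \<open>auto intro: always_eventually less_imp_le\<close>)
  have limx: "(\<lambda>n. x + t n *\<^sub>R v + t' n *\<^sub>R w) \<longlonglongrightarrow> x"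
    if "\<And>n. 0 < t n \<and> t n < hh n" "\<And>n. 0 < t' n \<and> t' n < hh n" for t t'
  proof -
    have "(\<lambda>n. x + t n *\<^sub>R v + t' n *\<^sub>R w) \<longlonglongrightarrow> x + 0 *\<^sub>R v + 0 *\<^sub>R w"
      by (intro tendsto_intros lim0 that)
    then show ?thesis by simp
  qed
  have cont: "isCont (pd a (pd c f)) x" for a c
    using smooth_continuous[OF smooth_pd[OF smooth_pd[OF f]]] x
    by (metis at_within_interior continuous_on_eq_continuous_within interior_subset subset_iff)
  have "(\<lambda>n. pd w (pd v f) (x + s n *\<^sub>R v + r n *\<^sub>R w)) \<longlonglongrightarrow> pd w (pd v f) x"
    by (rule isCont_tendsto_compose[OF cont limx]) (use b in blast)+
  moreover have "(\<lambda>n. pd w (pd v f) (x + s n *\<^sub>R v + r n *\<^sub>R w)) \<longlonglongrightarrow> pd v (pd w f) x"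
    unfolding eq by (rule isCont_tendsto_compose[OF cont limx]) (use b in blast)+
  ultimately show ?thesis using LIMSEQ_unique by blast
qed

lemma pd_commute_real:
  fixes f :: "'v \<Rightarrow> real"
  assumes f: "smooth_on S f" and x: "x \<in> S"
  shows "pd v (pd w f) x = pd w (pd v f) x"
proof -
  obtain X where X: "\<And>n. X n \<in> interior S" "X \<longlonglongrightarrow> x"
    using interior_dense x closure_sequential by blast
  have *: "(\<lambda>n. pd a (pd b f) (X n)) \<longlonglongrightarrow> pd a (pd b f) x" for a b
    by (rule continuous_on_tendsto_compose[OF smooth_continuous[OF smooth_pd[OF smooth_pd[OF f]]] X(2) x])
      (use X(1) interior_subset in \<open>blast intro: always_eventually\<close>)
  show ?thesis
    using *[of v w] *[of w v] LIMSEQ_unique by (simp add: pd_commute_interior[OF f X(1)])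
qed

lemma pd_commute:
  fixes f :: "'v \<Rightarrow> complex"
  assumes f: "smooth_on S f" and x: "x \<in> S"
  shows "pd v (pd w f) x = pd w (pd v f) x"
proof -
  have "h (pd v (pd w f) x) = h (pd w (pd v f) x)" if h: "bounded_linear h" for h :: "complex \<Rightarrow> real"
  proof -
    have "h (pd a (pd b f) x) = pd a (pd b (\<lambda>x. h (f x))) x" for a b
    proof -
      have "h (pd a (pd b f) x) = pd a (\<lambda>x. h (pd b f x)) x"
        by (simp add: pd_bounded_linear[OF h smooth_pd[OF f] x])
      also have "\<dots> = pd a (pd b (\<lambda>x. h (f x))) x"
        by (rule pd_cong) (simp_all add: pd_bounded_linear[OF h f] x)
      finally show ?thesis .
    qed
    then show ?thesis using pd_commute_real[OF smooth_bounded_linear[OF h f] x] by simp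
  qed
  from this[OF bounded_linear_Re] this[OF bounded_linear_Im] show ?thesis
    by (simp add: complex_eq_iff)
qed

section \<open>Derivatives along complex directions\<close>

text \<open>
  A pair \<open>c = (v, w)\<close> stands for the vector \<open>v + \<i> w\<close> in the complexification of the domain.  The
  derivatives along such vectors include the Wirtinger derivatives, and obey one set of rules.
\<close>
definition cd :: "'v \<times> 'v \<Rightarrow> ('v \<Rightarrow> complex) \<Rightarrow> 'v \<Rightarrow> complex" where
  "cd c f x = pd (fst c) f x + \<i> * pd (snd c) f x"

lemma smooth_cd [intro]: "smooth_on S f \<Longrightarrow> smooth_on S (cd c f)"
  unfolding cd_def[abs_def] by (intro smooth_add smooth_mult smooth_const smooth_pd)

lemma cd_cong: "(\<And>x. x \<in> S \<Longrightarrow> f x = g x) \<Longrightarrow> x \<in> S \<Longrightarrow> cd c f x = cd c g x"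
  unfolding cd_def using pd_cong[of f g x] by simp

lemma cd_const: "x \<in> S \<Longrightarrow> cd c (\<lambda>x. k) x = 0"
  by (simp add: cd_def pd_const)

lemma cd_add:
  "smooth_on S f \<Longrightarrow> smooth_on S g \<Longrightarrow> x \<in> S \<Longrightarrow> cd c (\<lambda>x. f x + g x) x = cd c f x + cd c g x"
  by (simp add: cd_def pd_add algebra_simps)

lemma cd_mult:
  "smooth_on S f \<Longrightarrow> smooth_on S g \<Longrightarrow> x \<in> S
    \<Longrightarrow> cd c (\<lambda>x. f x * g x) x = f x * cd c g x + cd c f x * g x"
  by (simp add: cd_def pd_mult algebra_simps)

lemma cd_cmult: "smooth_on S f \<Longrightarrow> x \<in> S \<Longrightarrow> cd c (\<lambda>x. k * f x) x = k * cd c f x"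
  by (simp add: cd_mult smooth_const cd_const)

lemma cd_minus: "smooth_on S f \<Longrightarrow> x \<in> S \<Longrightarrow> cd c (\<lambda>x. - f x) x = - cd c f x"
  using cd_cmult[of f x c "-1"] by simp

lemma cd_diff:
  "smooth_on S f \<Longrightarrow> smooth_on S g \<Longrightarrow> x \<in> S \<Longrightarrow> cd c (\<lambda>x. f x - g x) x = cd c f x - cd c g x"
  using cd_add[of f "\<lambda>x. - g x" x c] by (simp add: cd_minus smooth_minus)

lemma cd_sum:
  "(\<And>i. i \<in> X \<Longrightarrow> smooth_on S (f i)) \<Longrightarrow> x \<in> S
    \<Longrightarrow> cd c (\<lambda>x. \<Sum>i\<in>X. f i x) x = (\<Sum>i\<in>X. cd c (f i) x)"
  by (induction X rule: infinite_finite_induct) (simp_all add: cd_const cd_add smooth_sum)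

lemma cd_prod:
  "finite X \<Longrightarrow> (\<And>i. i \<in> X \<Longrightarrow> smooth_on S (f i)) \<Longrightarrow> x \<in> S
    \<Longrightarrow> cd c (\<lambda>x. \<Prod>i\<in>X. f i x) x = (\<Sum>i\<in>X. cd c (f i) x * (\<Prod>j\<in>X - {i}. f j x))"
proof (induction X rule: finite_induct)
  case empty
  then show ?case by (simp add: cd_const)
next
  case (insert k X)
  have "insert k X - {i} = insert k (X - {i})" "k \<notin> X - {i}" if "i \<in> X" for i
    using insert.hyps that by auto
  then have "(\<Sum>i\<in>X. cd c (f i) x * (\<Prod>j\<in>insert k X - {i}. f j x))
      = f k x * (\<Sum>i\<in>X. cd c (f i) x * (\<Prod>j\<in>X - {i}. f j x))"
    using insert.hyps by (simp add: sum_distrib_left mult.left_commute)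
  then show ?case
    using insert by (simp add: cd_mult smooth_prod)
qed

definition dir_cnj :: "'v \<times> 'v \<Rightarrow> 'v \<times> 'v" where
  "dir_cnj c = (fst c, - snd c)"

lemma cd_cnj:
  "smooth_on S f \<Longrightarrow> x \<in> S \<Longrightarrow> cd c (\<lambda>x. cnj (f x)) x = cnj (cd (dir_cnj c) f x)"
  using linear_neg[OF linear_pd[of f x], of "snd c"]
  by (simp add: cd_def dir_cnj_def pd_bounded_linear[OF bounded_linear_cnj])

lemma cd_commute:
  assumes f: "smooth_on S f" and x: "x \<in> S"
  shows "cd c (cd d f) x = cd d (cd c f) x"
proof -
  have expand: "cd c (cd d f) x = (pd (fst c) (pd (fst d) f) x + \<i> * pd (fst c) (pd (snd d) f) x)
      + \<i> * (pd (snd c) (pd (fst d) f) x + \<i> * pd (snd c) (pd (snd d) f) x)" for c d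
    unfolding cd_def[abs_def]
    by (simp add: pd_add pd_mult pd_const smooth_pd smooth_mult smooth_const f x)
  show ?thesis unfolding expand[of c d] expand[of d c]
    by (simp add: pd_commute[OF f x, of "fst d"] pd_commute[OF f x, of "snd d"] algebra_simps)
qed

definition dir_scale :: "complex \<Rightarrow> 'v \<times> 'v \<Rightarrow> 'v \<times> 'v" where
  "dir_scale k c = (Re k *\<^sub>R fst c - Im k *\<^sub>R snd c, Re k *\<^sub>R snd c + Im k *\<^sub>R fst c)"

lemma dir_cnj_add: "dir_cnj (c + d) = dir_cnj c + dir_cnj d"
  by (simp add: dir_cnj_def)

lemma dir_cnj_dir_cnj [simp]: "dir_cnj (dir_cnj c) = c"
  by (simp add: dir_cnj_def)

lemma dir_cnj_sum: "dir_cnj (sum f X) = (\<Sum>i\<in>X. dir_cnj (f i))"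
  by (induction X rule: infinite_finite_induct) (simp_all add: dir_cnj_add, simp_all add: dir_cnj_def zero_prod_def)

lemma dir_cnj_scale: "dir_cnj (dir_scale k c) = dir_scale (cnj k) (dir_cnj c)"
  by (simp add: dir_cnj_def dir_scale_def)

lemma cd_dir_add: "smooth_on S f \<Longrightarrow> x \<in> S \<Longrightarrow> cd (c + d) f x = cd c f x + cd d f x"
  using linear_add[OF linear_pd[of f x]] by (simp add: cd_def algebra_simps)

lemma cd_dir_zero: "smooth_on S f \<Longrightarrow> x \<in> S \<Longrightarrow> cd 0 f x = 0"
  using linear_0[OF linear_pd[of f x]] by (simp add: cd_def)

lemma cd_dir_scale:
  assumes "smooth_on S f" "x \<in> S"
  shows "cd (dir_scale k c) f x = k * cd c f x"
proof -
  note l = linear_pd[OF assms]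
  have "cd (dir_scale k c) f x = (Re k *\<^sub>R pd (fst c) f x - Im k *\<^sub>R pd (snd c) f x)
      + \<i> * (Re k *\<^sub>R pd (snd c) f x + Im k *\<^sub>R pd (fst c) f x)"
    by (simp only: cd_def dir_scale_def fst_conv snd_conv linear_add[OF l] linear_diff[OF l]
        linear_scale[OF l])
  also have "\<dots> = k * cd c f x"
    by (simp add: cd_def complex_eq_iff algebra_simps)
  finally show ?thesis .
qed

lemma cd_dir_sum: "smooth_on S f \<Longrightarrow> x \<in> S \<Longrightarrow> cd (\<Sum>i\<in>X. c i) f x = (\<Sum>i\<in>X. cd (c i) f x)"
  by (induction X rule: infinite_finite_induct) (simp_all add: cd_dir_zero cd_dir_add)

lemma cd_cong_fun:
  assumes "\<And>x. x \<in> S \<Longrightarrow> f x = g x" "x \<in> S"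
  shows "cd c (cd d f) x = cd c (cd d g) x"
  by (intro cd_cong[OF _ assms(2)] cd_cong assms(1))

lemma cd_rotate:
  assumes f: "smooth_on S f" and x: "x \<in> S"
  shows "cd c (cd d (cd e f)) x = cd d (cd e (cd c f)) x"
proof -
  have "cd c (cd d (cd e f)) x = cd d (cd c (cd e f)) x"
    by (rule cd_commute[OF smooth_cd[OF f] x])
  also have "\<dots> = cd d (cd e (cd c f)) x"
    by (intro cd_cong[OF _ x] cd_commute f)
  finally show ?thesis .
qed

lemma cd_cd_add:
  assumes "smooth_on S f" "smooth_on S g" "x \<in> S"
  shows "cd c (cd d (\<lambda>x. f x + g x)) x = cd c (cd d f) x + cd c (cd d g) x"
proof -
  have "cd c (cd d (\<lambda>x. f x + g x)) x = cd c (\<lambda>x. cd d f x + cd d g x) x"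
    by (rule cd_cong[OF cd_add[OF assms(1,2)] assms(3)])
  then show ?thesis by (simp add: cd_add smooth_cd assms)
qed

lemma cd_cd_cmult:
  assumes "smooth_on S f" "x \<in> S"
  shows "cd c (cd d (\<lambda>x. k * f x)) x = k * cd c (cd d f) x"
proof -
  have "cd c (cd d (\<lambda>x. k * f x)) x = cd c (\<lambda>x. k * cd d f x) x"
    by (rule cd_cong[OF cd_cmult[OF assms(1)] assms(2)])
  then show ?thesis by (simp add: cd_cmult smooth_cd assms)
qed

lemma cd_cd_const:
  assumes "x \<in> S"
  shows "cd c (cd d (\<lambda>x. k)) x = 0"
proof -
  have "cd c (cd d (\<lambda>x. k)) x = cd c (\<lambda>x. 0) x"
    by (rule cd_cong[OF cd_const assms])
  then show ?thesis by (simp add: cd_const assms)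
qed

lemma cd_cd_sum:
  assumes "\<And>i. i \<in> X \<Longrightarrow> smooth_on S (f i)" "x \<in> S"
  shows "cd c (cd d (\<lambda>x. \<Sum>i\<in>X. f i x)) x = (\<Sum>i\<in>X. cd c (cd d (f i)) x)"
  using assms by (induction X rule: infinite_finite_induct) (simp_all add: cd_cd_const cd_cd_add smooth_sum)

text \<open>
  At a common zero of \<open>f\<close> and \<open>h\<close>, derivatives of \<open>g\<close> and second derivatives of \<open>f\<close> and \<open>h\<close> drop out.
\<close>
lemma
  assumes g: "smooth_on S g" and f: "smooth_on S f" and h: "smooth_on S h" and x: "x \<in> S"
    and zero: "f x = 0" "h x = 0"
  shows cd_mult_vanish: "cd c (\<lambda>x. g x * (f x * h x)) x = 0"
    and cd_cd_mult_vanish: "cd c (cd d (\<lambda>x. g x * (f x * h x))) x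
      = g x * (cd c f x * cd d h x + cd d f x * cd c h x)"
proof -
  have 1: "cd d (\<lambda>x. g x * (f x * h x)) x = g x * (f x * cd d h x + cd d f x * h x) + cd d g x * (f x * h x)"
    if "x \<in> S" for x d
    using that by (simp add: cd_mult smooth_mult f g h)
  show "cd c (\<lambda>x. g x * (f x * h x)) x = 0" using zero by (simp add: 1[OF x])
  have "cd c (cd d (\<lambda>x. g x * (f x * h x))) x
      = cd c (\<lambda>x. g x * (f x * cd d h x + cd d f x * h x) + cd d g x * (f x * h x)) x"
    by (rule cd_cong[OF 1 x])
  then show "cd c (cd d (\<lambda>x. g x * (f x * h x))) x
      = g x * (cd c f x * cd d h x + cd d f x * cd c h x)"
    using zero x by (simp add: cd_mult cd_add smooth_add smooth_mult smooth_cd f g h algebra_simps)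
qed

section \<open>Derivatives of the inverse and of the determinant\<close>

lemma smooth_det:
  fixes M :: "'v \<Rightarrow> complex^'n^'n"
  shows "(\<And>i j. smooth_on S (\<lambda>x. M x $ i $ j)) \<Longrightarrow> smooth_on S (\<lambda>x. det (M x))"
  unfolding det_def by (intro smooth_sum smooth_mult smooth_const smooth_prod)

text \<open>
  Cramer's rule writes the entries of the inverse as rational functions of the entries of \<open>M\<close>.
\<close>
lemma smooth_matrix_inv:
  fixes M :: "'v \<Rightarrow> complex^'n^'n"
  assumes M: "\<And>i j. smooth_on S (\<lambda>x. M x $ i $ j)"
    and inv: "\<And>x. x \<in> S \<Longrightarrow> invertible (M x)"
  shows "smooth_on S (\<lambda>x. matrix_inv (M x) $ i $ j)"
proof (rule smooth_on_cong)
  let ?N = "\<lambda>x. \<chi> k l. if l = i then (axis j 1 :: complex^'n) $ k else M x $ k $ l"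
  show "smooth_on S (\<lambda>x. det (?N x) * inverse (det (M x)))"
  proof (intro smooth_mult smooth_inverse smooth_det M)
    show "smooth_on S (\<lambda>x. ?N x $ k $ l)" for k l
      by (cases "l = i") (simp_all add: M smooth_const)
    show "det (M x) \<noteq> 0" if "x \<in> S" for x
      using inv[OF that] by (simp add: invertible_det_nz)
  qed
  fix x assume x: "x \<in> S"
  define v where "v = (\<chi> k. matrix_inv (M x) $ k $ j)"
  have "(M x *v v) $ k = (M x ** matrix_inv (M x)) $ k $ j" for k
    by (simp add: matrix_vector_mult_def matrix_matrix_mult_def v_def)
  then have "M x *v v = axis j 1"
    by (simp add: matrix_inv_right[OF inv[OF x]] vec_eq_iff mat_def axis_def)
  then have "v = (\<chi> k. det (\<chi> a b. if b = k then (axis j 1 :: complex^'n) $ a else M x $ a $ b) / det (M x))"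
    using cramer[of "M x" v "axis j 1"] inv[OF x] by (simp add: invertible_det_nz)
  then have "v $ i = det (?N x) / det (M x)" by simp
  then show "matrix_inv (M x) $ i $ j = det (?N x) * inverse (det (M x))"
    by (simp add: v_def divide_inverse)
qed

text \<open>
  Smoothness of the inverse being known, its derivative follows from \<open>M\<^sup>-\<^sup>1 M = 1\<close> and the product rule.
\<close>
lemma cd_matrix_inv:
  fixes M :: "'v \<Rightarrow> complex^'n^'n"
  assumes M: "\<And>i j. smooth_on S (\<lambda>x. M x $ i $ j)"
    and inv: "\<And>x. x \<in> S \<Longrightarrow> invertible (M x)" and x: "x \<in> S"
  shows "cd c (\<lambda>x. matrix_inv (M x) $ i $ j) x
    = - (\<Sum>k\<in>UNIV. \<Sum>l\<in>UNIV. matrix_inv (M x) $ i $ k * cd c (\<lambda>x. M x $ k $ l) x * matrix_inv (M x) $ l $ j)"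
proof -
  define N where "N x = matrix_inv (M x)" for x
  have N: "smooth_on S (\<lambda>x. N x $ i $ j)" for i j
    unfolding N_def by (rule smooth_matrix_inv[OF M inv])
  define dM where "dM = (\<chi> k l. cd c (\<lambda>x. M x $ k $ l) x)"
  define dN where "dN = (\<chi> k l. cd c (\<lambda>x. N x $ k $ l) x)"
  have "dN ** M x + N x ** dM = 0"
  proof -
    have "(dN ** M x + N x ** dM) $ i $ j = 0" for i j
    proof -
      have "(dN ** M x + N x ** dM) $ i $ j
          = (\<Sum>k\<in>UNIV. N x $ i $ k * cd c (\<lambda>x. M x $ k $ j) x + cd c (\<lambda>x. N x $ i $ k) x * M x $ k $ j)"
        by (simp add: dN_def dM_def matrix_matrix_mult_def sum.distrib)
      also have "\<dots> = cd c (\<lambda>x. \<Sum>k\<in>UNIV. N x $ i $ k * M x $ k $ j) x"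
        by (simp add: cd_sum cd_mult smooth_mult N M x)
      also have "\<dots> = cd c (\<lambda>x. (mat 1 :: complex^'n^'n) $ i $ j) x"
      proof (rule cd_cong[OF _ x])
        fix y assume "y \<in> S"
        then have "N y ** M y = mat 1" unfolding N_def by (intro matrix_inv_left inv)
        then show "(\<Sum>k\<in>UNIV. N y $ i $ k * M y $ k $ j) = (mat 1 :: complex^'n^'n) $ i $ j"
          by (simp add: matrix_matrix_mult_def vec_eq_iff)
      qed
      finally show ?thesis by (simp add: cd_const x)
    qed
    then show ?thesis by (simp add: vec_eq_iff)
  qed
  then have "(dN ** M x + N x ** dM) ** N x = 0" by simp
  moreover have "(dN ** M x + N x ** dM) ** N x = dN ** (M x ** N x) + N x ** dM ** N x"
    unfolding matrix_mul_assoc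
    by (simp add: matrix_matrix_mult_def[of _ "N x"] vec_eq_iff algebra_simps sum.distrib)
  ultimately have "dN + N x ** dM ** N x = 0"
    using matrix_inv_right[OF inv[OF x]] by (simp add: N_def)
  then have "dN $ i $ j + (N x ** dM ** N x) $ i $ j = 0"
    by (metis vector_add_component zero_index)
  then have "dN $ i $ j = - (N x ** dM ** N x) $ i $ j" by (simp add: add_eq_0_iff2)
  also have "(N x ** dM ** N x) $ i $ j = (\<Sum>k\<in>UNIV. \<Sum>l\<in>UNIV. N x $ i $ k * dM $ k $ l * N x $ l $ j)"
    unfolding matrix_matrix_mult_def by (subst sum.swap) (simp add: sum_distrib_right)
  finally show ?thesis by (simp add: dN_def dM_def N_def)
qed

text \<open>
  Jacobi's formula.  The product rule replaces one row of \<open>M\<close> at a time by its derivative; writing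
  this row as a combination of the rows of \<open>M\<close>, with coefficients from \<open>X M\<^sup>-\<^sup>1\<close> for the derivative \<open>X\<close>, Cramer's rule
  evaluates the determinant.
\<close>
lemma cd_det:
  fixes M :: "'v \<Rightarrow> complex^'n^'n"
  assumes M: "\<And>i j. smooth_on S (\<lambda>x. M x $ i $ j)"
    and inv: "invertible (M x)" and x: "x \<in> S"
  shows "cd c (\<lambda>x. det (M x)) x
    = det (M x) * (\<Sum>i\<in>UNIV. \<Sum>j\<in>UNIV. matrix_inv (M x) $ i $ j * cd c (\<lambda>x. M x $ j $ i) x)"
proof -
  define X where "X = (\<chi> i j. cd c (\<lambda>x. M x $ i $ j) x)"
  have "cd c (\<lambda>x. det (M x)) x = (\<Sum>p\<in>{p. p permutes UNIV}. of_int (sign p) *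
      (\<Sum>i\<in>UNIV. X $ i $ p i * (\<Prod>j\<in>UNIV - {i}. M x $ j $ p j)))"
    unfolding det_def
    by (simp add: cd_sum cd_cmult cd_prod smooth_mult smooth_prod smooth_const M x X_def)
  also have "\<dots> = (\<Sum>i\<in>UNIV. \<Sum>p\<in>{p. p permutes UNIV}. of_int (sign p) *
      (X $ i $ p i * (\<Prod>j\<in>UNIV - {i}. M x $ j $ p j)))"
    unfolding sum_distrib_left by (rule sum.swap)
  also have "\<dots> = (\<Sum>i\<in>UNIV. det (\<chi> k. if k = i then row i X else row k (M x)))"
  proof (rule sum.cong[OF refl])
    fix i :: 'n
    have "(\<Prod>k\<in>UNIV. (\<chi> k. if k = i then row i X else row k (M x)) $ k $ p k)
        = X $ i $ p i * (\<Prod>j\<in>UNIV - {i}. M x $ j $ p j)" for p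
      by (subst prod.remove[of _ i]) (auto simp: row_def intro!: prod.cong)
    then show "(\<Sum>p\<in>{p. p permutes UNIV}. of_int (sign p) *
        (X $ i $ p i * (\<Prod>j\<in>UNIV - {i}. M x $ j $ p j)))
      = det (\<chi> k. if k = i then row i X else row k (M x))"
      by (simp add: det_def)
  qed
  also have "\<dots> = (\<Sum>i\<in>UNIV. (X ** matrix_inv (M x)) $ i $ i * det (M x))"
  proof (rule sum.cong[OF refl])
    fix i :: 'n
    have "X = (X ** matrix_inv (M x)) ** M x"
      using matrix_inv_left[OF inv] by (simp add: matrix_mul_assoc[symmetric])
    then have "X $ i $ l = ((X ** matrix_inv (M x)) ** M x) $ i $ l" for l by simp
    then have row: "row i X = (\<Sum>k\<in>UNIV. (X ** matrix_inv (M x)) $ i $ k *s row k (M x))"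
      by (simp add: vec_eq_iff row_def matrix_matrix_mult_def[of _ "M x"])
    show "det (\<chi> k. if k = i then row i X else row k (M x)) = (X ** matrix_inv (M x)) $ i $ i * det (M x)"
      unfolding row by (rule cramer_lemma_transpose)
  qed
  also have "\<dots> = det (M x) * (\<Sum>i\<in>UNIV. \<Sum>j\<in>UNIV. matrix_inv (M x) $ j $ i * X $ i $ j)"
    by (simp add: matrix_matrix_mult_def sum_distrib_left mult.commute)
  also have "(\<Sum>i\<in>UNIV. \<Sum>j\<in>UNIV. matrix_inv (M x) $ j $ i * X $ i $ j)
      = (\<Sum>i\<in>UNIV. \<Sum>j\<in>UNIV. matrix_inv (M x) $ i $ j * X $ j $ i)"
    by (rule sum.swap)
  finally show ?thesis by (simp add: X_def)
qed

lemma Ln_has_derivative: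
  assumes f: "smooth_on S f" and x: "x \<in> S" and pos: "f x \<notin> \<real>\<^sub>\<le>\<^sub>0"
  shows "((\<lambda>x. Ln (f x)) has_derivative (\<lambda>v. pd v f x / f x)) (at x within S)"
proof -
  have "(Ln has_derivative (\<lambda>h. inverse (f x) * h)) (at (f x))"
    using has_field_derivative_Ln[OF pos] by (simp add: has_field_derivative_def)
  from has_derivative_compose[OF smooth_has_derivative[OF f x] this]
  show ?thesis by (simp add: divide_inverse mult.commute)
qed

lemma Ck_on_Ln:
  assumes pos: "\<And>x. x \<in> S \<Longrightarrow> f x \<notin> \<real>\<^sub>\<le>\<^sub>0" and f: "smooth_on S f"
  shows "Ck_on n S (\<lambda>x. Ln (f x))"
proof (cases n)
  case 0
  then show ?thesis using pos smooth_continuous[OF f] by (auto intro: continuous_intros)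
next
  case (Suc m)
  show ?thesis unfolding Suc
  proof (rule Ck_on_SucI[where f' = "\<lambda>v x. pd v f x / f x"])
    show "((\<lambda>x. Ln (f x)) has_derivative (\<lambda>v. pd v f x / f x)) (at x within S)" if "x \<in> S" for x
      by (rule Ln_has_derivative[OF f that pos[OF that]])
    have "f x \<noteq> 0" if "x \<in> S" for x using pos[OF that] by auto
    then have "smooth_on S (\<lambda>x. pd v f x * inverse (f x))" for v
      by (intro smooth_mult smooth_inverse smooth_pd f)
    then show "Ck_on m S (\<lambda>x. pd v f x / f x)" for v
      by (simp add: smooth_on_def divide_inverse)
  qed
qed

text \<open>
  The determinant of a positive definite matrix is positive, so the real logarithm agrees on \<open>S\<close> with
  the principal complex one, which can be differentiated along complex directions.
\<close>
lemma
  fixes M :: "'v \<Rightarrow> complex^'n^'n"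
  assumes M: "\<And>i j. smooth_on S (\<lambda>x. M x $ i $ j)" and pos: "\<And>x. x \<in> S \<Longrightarrow> pos_def (M x)"
  shows smooth_ln_det: "smooth_on S (\<lambda>x. complex_of_real (ln (Re (det (M x)))))"
    and cd_ln_det: "x \<in> S \<Longrightarrow> cd c (\<lambda>x. complex_of_real (ln (Re (det (M x))))) x
      = (\<Sum>i\<in>UNIV. \<Sum>j\<in>UNIV. matrix_inv (M x) $ i $ j * cd c (\<lambda>x. M x $ j $ i) x)"
proof -
  have nz: "det (M x) \<notin> \<real>\<^sub>\<le>\<^sub>0" if "x \<in> S" for x
    using det_pos_def[OF pos[OF that]] by (auto simp: complex_nonpos_Reals_iff)
  have eq: "complex_of_real (ln (Re (det (M x)))) = Ln (det (M x))" if "x \<in> S" for x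
    using det_pos_def[OF pos[OF that]] by (metis Ln_of_real)
  have "smooth_on S (\<lambda>x. Ln (det (M x)))"
    unfolding smooth_on_def using Ck_on_Ln[OF nz smooth_det[OF M]] by blast
  then show "smooth_on S (\<lambda>x. complex_of_real (ln (Re (det (M x)))))"
    by (rule smooth_on_cong) (rule eq)
  assume x: "x \<in> S"
  have "cd c (\<lambda>x. complex_of_real (ln (Re (det (M x))))) x = cd c (\<lambda>x. Ln (det (M x))) x"
    by (rule cd_cong[OF eq x])
  also have "\<dots> = cd c (\<lambda>x. det (M x)) x / det (M x)"
    using pd_eqI[OF Ln_has_derivative[OF smooth_det[OF M] x nz[OF x]] x]
    by (simp add: cd_def add_divide_distrib)
  also have "\<dots> = (\<Sum>i\<in>UNIV. \<Sum>j\<in>UNIV. matrix_inv (M x) $ i $ j * cd c (\<lambda>x. M x $ j $ i) x)"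
    using cd_det[OF M invertible_pos_def[OF pos[OF x]] x, of c] nz[OF x] by auto
  finally show "cd c (\<lambda>x. complex_of_real (ln (Re (det (M x))))) x
      = (\<Sum>i\<in>UNIV. \<Sum>j\<in>UNIV. matrix_inv (M x) $ i $ j * cd c (\<lambda>x. M x $ j $ i) x)" .
qed

text \<open>
  The second derivative of \<open>log det M\<close>: a part linear in the second derivatives of \<open>M\<close>, and minus
  \<open>tr (M\<^sup>-\<^sup>1 M\<^sub>c M\<^sup>-\<^sup>1 M\<^sub>d)\<close>, here arranged like the sum in \<open>pos_def_contraction_nonneg\<close>.
\<close>
lemma cd_trace_inv:
  fixes M :: "'v \<Rightarrow> complex^'n^'n"
  assumes M: "\<And>i j. smooth_on S (\<lambda>x. M x $ i $ j)"
    and inv: "\<And>x. x \<in> S \<Longrightarrow> invertible (M x)" and x: "x \<in> S"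
  shows "cd c (\<lambda>x. \<Sum>i\<in>UNIV. \<Sum>j\<in>UNIV. matrix_inv (M x) $ i $ j * cd d (\<lambda>x. M x $ j $ i) x) x
    = (\<Sum>i\<in>UNIV. \<Sum>j\<in>UNIV. matrix_inv (M x) $ i $ j * cd c (cd d (\<lambda>x. M x $ j $ i)) x)
      - (\<Sum>k\<in>UNIV. \<Sum>i\<in>UNIV. matrix_inv (M x) $ i $ k * (\<Sum>l\<in>UNIV. \<Sum>j\<in>UNIV. matrix_inv (M x) $ l $ j *
           (cd c (\<lambda>x. M x $ k $ l) x * cd d (\<lambda>x. M x $ j $ i) x)))"
proof -
  let ?N = "\<lambda>x. matrix_inv (M x)"
  have N: "smooth_on S (\<lambda>x. ?N x $ i $ j)" for i j
    by (rule smooth_matrix_inv[OF M inv])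
  have "cd c (\<lambda>x. \<Sum>i\<in>UNIV. \<Sum>j\<in>UNIV. ?N x $ i $ j * cd d (\<lambda>x. M x $ j $ i) x) x
      = (\<Sum>i\<in>UNIV. \<Sum>j\<in>UNIV. ?N x $ i $ j * cd c (cd d (\<lambda>x. M x $ j $ i)) x
          + cd c (\<lambda>x. ?N x $ i $ j) x * cd d (\<lambda>x. M x $ j $ i) x)"
    by (simp add: cd_sum cd_mult smooth_sum smooth_mult smooth_cd N M x)
  also have "\<dots> = (\<Sum>i\<in>UNIV. \<Sum>j\<in>UNIV. ?N x $ i $ j * cd c (cd d (\<lambda>x. M x $ j $ i)) x)
      - (\<Sum>i\<in>UNIV. \<Sum>j\<in>UNIV. \<Sum>k\<in>UNIV. \<Sum>l\<in>UNIV. ?N x $ i $ k * cd c (\<lambda>x. M x $ k $ l) x * ?N x $ l $ j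
          * cd d (\<lambda>x. M x $ j $ i) x)"
    by (simp add: cd_matrix_inv[OF M inv x] sum_subtractf sum_distrib_right)
  also have "(\<Sum>i\<in>UNIV. \<Sum>j\<in>UNIV. \<Sum>k\<in>UNIV. \<Sum>l\<in>UNIV. ?N x $ i $ k * cd c (\<lambda>x. M x $ k $ l) x * ?N x $ l $ j
          * cd d (\<lambda>x. M x $ j $ i) x)
      = (\<Sum>k\<in>UNIV. \<Sum>i\<in>UNIV. \<Sum>l\<in>UNIV. \<Sum>j\<in>UNIV. ?N x $ i $ k * cd c (\<lambda>x. M x $ k $ l) x * ?N x $ l $ j
          * cd d (\<lambda>x. M x $ j $ i) x)"
  proof -
    have "(\<Sum>i\<in>UNIV. \<Sum>j\<in>UNIV. \<Sum>k\<in>UNIV. \<Sum>l\<in>UNIV. h i j k l)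
        = (\<Sum>k\<in>UNIV. \<Sum>i\<in>UNIV. \<Sum>l\<in>UNIV. \<Sum>j\<in>UNIV. h i j k l)" for h :: "'n \<Rightarrow> 'n \<Rightarrow> 'n \<Rightarrow> 'n \<Rightarrow> complex"
    proof -
      have "(\<Sum>i\<in>UNIV. \<Sum>j\<in>UNIV. \<Sum>k\<in>UNIV. \<Sum>l\<in>UNIV. h i j k l)
          = (\<Sum>i\<in>UNIV. \<Sum>k\<in>UNIV. \<Sum>j\<in>UNIV. \<Sum>l\<in>UNIV. h i j k l)"
        by (rule sum.cong[OF refl], rule sum.swap)
      also have "\<dots> = (\<Sum>k\<in>UNIV. \<Sum>i\<in>UNIV. \<Sum>j\<in>UNIV. \<Sum>l\<in>UNIV. h i j k l)"
        by (rule sum.swap)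
      also have "\<dots> = (\<Sum>k\<in>UNIV. \<Sum>i\<in>UNIV. \<Sum>l\<in>UNIV. \<Sum>j\<in>UNIV. h i j k l)"
        by (rule sum.cong[OF refl], rule sum.cong[OF refl], rule sum.swap)
      finally show ?thesis .
    qed
    then show ?thesis .
  qed
  finally show ?thesis by (simp add: sum_distrib_left mult.assoc mult.left_commute)
qed

end

section \<open>The flow as a function of time and place\<close>

locale mixed_flow =
  fixes U :: "((complex^'k) \<times> (complex^'l)) set"
    and I :: "real set"
    and u :: "real \<Rightarrow> (complex^'k) \<times> (complex^'l) \<Rightarrow> real"
  assumes open_U: "open U"
    and interval_I: "is_interval I" and interior_I: "interior I \<noteq> {}"
    and smooth_u: "smooth_on (I \<times> U) (\<lambda>(t, p). u t p)"
    and u_class: "\<And>t. t \<in> I \<Longrightarrow> u t \<in> E_class U"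
    and flow: "\<And>t p. t \<in> I \<Longrightarrow> p \<in> U \<Longrightarrow>
           dt I u t p = ln (Re (det (hess_zz (u t) p))) - ln (Re (det (- hess_ww (u t) p)))"
begin

lemma I_islimpt:
  assumes "t \<in> I"
  shows "t islimpt I"
proof (rule connected_imp_perfect)
  show "connected I" using interval_I is_interval_connected_1 by blast
  show "I \<noteq> {s}" for s using interior_I by auto
qed (rule assms)

lemma regular_domain_product: "regular_domain (I \<times> U)"
proof
  fix x i and e :: real
  assume x: "x \<in> I \<times> U" and i: "(i :: real \<times> (complex^'k) \<times> (complex^'l)) \<in> Basis" and e: "e > 0"
  obtain t p where tp: "x = (t, p)" "t \<in> I" "p \<in> U" using x by auto
  show "\<exists>d. 0 < \<bar>d\<bar> \<and> \<bar>d\<bar> < e \<and> x + d *\<^sub>R i \<in> I \<times> U"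
  proof (cases "i = (1, 0)")
    case True
    obtain s where "s \<in> I" "s \<noteq> t" "\<bar>s - t\<bar> < e"
      using I_islimpt[OF tp(2)] e by (auto simp: islimpt_approachable dist_real_def)
    then show ?thesis using True tp by (intro exI[of _ "s - t"]) auto
  next
    case False
    then obtain b where b: "i = (0, b)" "b \<in> Basis" using i by (auto simp: Basis_prod_def)
    obtain r where r: "r > 0" "ball p r \<subseteq> U" using open_U tp(3) open_contains_ball by blast
    define d where "d = min e r / 2"
    have "dist p (p + d *\<^sub>R b) = \<bar>d\<bar>" using b by (simp add: dist_norm)
    then have "p + d *\<^sub>R b \<in> U" using r e by (intro subsetD[OF r(2)]) (simp add: d_def)
    then show ?thesis using tp b r e by (intro exI[of _ d]) (simp add: d_def)
  qed
next
  have "I \<subseteq> closure (interior I)"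
    using convex_closure_interior[of I] interval_I interior_I closure_subset is_interval_convex by blast
  then show "I \<times> U \<subseteq> closure (interior (I \<times> U))"
    using closure_subset[of U] by (auto simp: interior_Times closure_Times interior_open[OF open_U])
qed

sublocale regular_domain "I \<times> U" by (rule regular_domain_product)

text \<open>
  Together with \<open>dt_slice\<close>, this turns derivatives at a fixed time or at a fixed place into directional
  derivatives of one function on \<open>I \<times> U\<close>.
\<close>
lemma frechet_derivative_slice:
  assumes f: "smooth_on (I \<times> U) f" and t: "t \<in> I" and p: "p \<in> U"
    and g: "\<And>q. q \<in> U \<Longrightarrow> g q = f (t, q)"
  shows "frechet_derivative g (at p) h = pd (0, h) f (t, p)"
proof -
  have f': "(f has_derivative (\<lambda>v. pd v f (t, p))) (at (t, p) within Pair t ` U)"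
    by (rule has_derivative_subset[OF smooth_has_derivative[OF f]]) (use t p in auto)
  have "(Pair t has_derivative Pair 0) (at p within U)"
    by (auto intro!: derivative_eq_intros)
  from has_derivative_in_compose[OF this f'] have "((\<lambda>q. f (t, q)) has_derivative (\<lambda>h. pd (0, h) f (t, p))) (at p within U)"
    by simp
  then have "((\<lambda>q. f (t, q)) has_derivative (\<lambda>h. pd (0, h) f (t, p))) (at p)"
    using at_within_open[OF p open_U] by simp
  then have "(g has_derivative (\<lambda>h. pd (0, h) f (t, p))) (at p)"
    by (rule has_derivative_transform_within_open[OF _ open_U p]) (simp add: g)
  then show ?thesis by (simp add: frechet_derivative_at[symmetric])
qed

lemma dt_slice:
  assumes f: "smooth_on (I \<times> U) f" and t: "t \<in> I" and p: "p \<in> U"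
    and g: "\<And>s. s \<in> I \<Longrightarrow> g s p = f (s, p)"
  shows "dt I g t p = pd (1, 0) f (t, p)"
proof -
  have f': "(f has_derivative (\<lambda>v. pd v f (t, p))) (at (t, p) within (\<lambda>s. (s, p)) ` I)"
    by (rule has_derivative_subset[OF smooth_has_derivative[OF f]]) (use t p in auto)
  have "((\<lambda>s. (s, p)) has_derivative (\<lambda>h. (h, 0))) (at t within I)"
    by (auto intro!: derivative_eq_intros)
  from has_derivative_in_compose[OF this f'] have "((\<lambda>s. f (s, p)) has_derivative (\<lambda>h. pd (h, 0) f (t, p))) (at t within I)"
    by simp
  then have "((\<lambda>s. g s p) has_derivative (\<lambda>h. pd (h, 0) f (t, p))) (at t within I)"
    by (rule has_derivative_transform[OF t, rotated]) (simp add: g)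
  moreover have "(\<lambda>h. pd (h, 0) f (t, p)) = (\<lambda>h. h *\<^sub>R pd (1, 0) f (t, p))"
  proof
    fix h :: real
    have "pd (h, 0) f (t, p) = pd (h *\<^sub>R (1, 0)) f (t, p)" by simp
    also have "\<dots> = h *\<^sub>R pd (1, 0) f (t, p)"
      by (rule linear_scale[OF linear_pd[OF f]]) (simp add: t p)
    finally show "pd (h, 0) f (t, p) = h *\<^sub>R pd (1, 0) f (t, p)" .
  qed
  ultimately have "((\<lambda>s. g s p) has_vector_derivative pd (1, 0) f (t, p)) (at t within I)"
    by (simp only: has_vector_derivative_def)
  then show ?thesis
    unfolding dt_def using I_islimpt[OF t] by (intro vector_derivative_within) (simp_all add: trivial_limit_within)
qed

text \<open>
  The directions of \<open>\<partial>/\<partial>t\<close>, \<open>\<partial>/\<partial>z\<^sub>a\<close> and \<open>\<partial>/\<partial>w\<^sub>a\<close>, as vectors \<open>v + \<i> w\<close> coded by pairs.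
\<close>
definition tdir where "tdir = ((1, 0), 0 :: real \<times> (complex^'k) \<times> (complex^'l))"
definition zdir where "zdir a = ((0, (1/2) *\<^sub>R axis a 1, 0), (0, - (1/2) *\<^sub>R axis a \<i>, 0 :: complex^'l))" for a :: 'k
definition wdir where "wdir a = ((0, 0 :: complex^'k, (1/2) *\<^sub>R axis a 1), (0, 0, - (1/2) *\<^sub>R axis a \<i>))" for a :: 'l

abbreviation "zbdir a \<equiv> dir_cnj (zdir a)"
abbreviation "wbdir a \<equiv> dir_cnj (wdir a)"

lemma wirtinger_slice:
  assumes f: "smooth_on (I \<times> U) f" and t: "t \<in> I" and p: "p \<in> U"
    and g: "\<And>q. q \<in> U \<Longrightarrow> g q = f (t, q)"
  shows "dz a g p = cd (zdir a) f (t, p)" "dzbar a g p = cd (zbdir a) f (t, p)"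
    and "dw b g p = cd (wdir b) f (t, p)" "dwbar b g p = cd (wbdir b) f (t, p)"
proof -
  have l: "linear (\<lambda>v. pd v f (t, p))" by (rule linear_pd[OF f]) (use t p in auto)
  note slice = frechet_derivative_slice[OF f t p g]
  have sc: "pd (0, r *\<^sub>R v, 0) f (t, p) = r *\<^sub>R pd (0, v, 0) f (t, p)"
    "pd (0, 0, r *\<^sub>R w) f (t, p) = r *\<^sub>R pd (0, 0, w) f (t, p)" for r v w
    using linear_scale[OF l, of r "(0, v, 0)"] linear_scale[OF l, of r "(0, 0, w)"] by (simp_all only: scaleR_Pair scaleR_zero_right)
  have ng: "pd (0, - v, 0) f (t, p) = - pd (0, v, 0) f (t, p)"
    "pd (0, 0, - w) f (t, p) = - pd (0, 0, w) f (t, p)" for v w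
    using linear_neg[OF l, of "(0, v, 0)"] linear_neg[OF l, of "(0, 0, w)"] by (simp_all only: uminus_Pair minus_zero)
  show "dz a g p = cd (zdir a) f (t, p)" "dzbar a g p = cd (zbdir a) f (t, p)"
    "dw b g p = cd (wdir b) f (t, p)" "dwbar b g p = cd (wbdir b) f (t, p)"
    unfolding dz_def dzbar_def dw_def dwbar_def cd_def zdir_def wdir_def dir_cnj_def
    by (simp_all add: slice sc ng complex_eq_iff field_simps)
qed

lemma dt_eq_cd:
  assumes f: "smooth_on (I \<times> U) f" and t: "t \<in> I" and p: "p \<in> U"
    and g: "\<And>s. s \<in> I \<Longrightarrow> g s p = f (s, p)"
  shows "dt I g t p = cd tdir f (t, p)"
proof -
  have "pd 0 f (t, p) = 0" by (rule linear_0[OF linear_pd[OF f]]) (simp add: t p)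
  then show ?thesis using dt_slice[where f = f and g = g, OF assms] by (simp add: cd_def tdir_def)
qed

definition uc :: "real \<times> (complex^'k) \<times> (complex^'l) \<Rightarrow> complex" where
  "uc x = complex_of_real (u (fst x) (snd x))"

definition A where "A x = hess_zz (u (fst x)) (snd x)"
definition B where "B x = hess_zw (u (fst x)) (snd x)"
definition D where "D x = hess_ww (u (fst x)) (snd x)"

lemma smooth_uc: "smooth_on (I \<times> U) uc"
  using smooth_bounded_linear[OF bounded_linear_of_real smooth_u]
  by (simp add: uc_def[abs_def] case_prod_beta)

lemma hessian_slice:
  assumes x: "x \<in> I \<times> U"
  shows "A x $ i $ j = cd (zdir i) (cd (zbdir j) uc) x"
    and "B x $ i $ b = cd (zdir i) (cd (wbdir b) uc) x"
    and "D x $ a $ b = cd (wdir a) (cd (wbdir b) uc) x"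
proof -
  obtain t p where tp: "x = (t, p)" "t \<in> I" "p \<in> U" using x by auto
  have 1: "dzbar j (\<lambda>q. complex_of_real (u t q)) q = cd (zbdir j) uc (t, q)"
    "dwbar b (\<lambda>q. complex_of_real (u t q)) q = cd (wbdir b) uc (t, q)" if "q \<in> U" for j b q
    by (rule wirtinger_slice[OF smooth_uc tp(2) that]; simp add: uc_def)+
  show "A x $ i $ j = cd (zdir i) (cd (zbdir j) uc) x"
    "B x $ i $ b = cd (zdir i) (cd (wbdir b) uc) x"
    "D x $ a $ b = cd (wdir a) (cd (wbdir b) uc) x"
    unfolding A_def B_def D_def hess_zz_def hess_zw_def hess_ww_def
    using wirtinger_slice[OF smooth_cd[OF smooth_uc] tp(2,3)] 1 by (simp_all add: tp(1))
qed

lemma smooth_A: "smooth_on (I \<times> U) (\<lambda>x. A x $ i $ j)"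
  by (rule smooth_on_cong[OF smooth_cd[OF smooth_cd[OF smooth_uc]] hessian_slice(1)])
lemma smooth_B: "smooth_on (I \<times> U) (\<lambda>x. B x $ i $ b)"
  by (rule smooth_on_cong[OF smooth_cd[OF smooth_cd[OF smooth_uc]] hessian_slice(2)])
lemma smooth_D: "smooth_on (I \<times> U) (\<lambda>x. D x $ a $ b)"
  by (rule smooth_on_cong[OF smooth_cd[OF smooth_cd[OF smooth_uc]] hessian_slice(3)])
lemma smooth_uminus_D: "smooth_on (I \<times> U) (\<lambda>x. (- D x) $ a $ b)"
  using smooth_minus[OF smooth_D] by simp

lemma pos_def_A: "x \<in> I \<times> U \<Longrightarrow> pos_def (A x)"
  and pos_def_uminus_D: "x \<in> I \<times> U \<Longrightarrow> pos_def (- D x)"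
  using u_class by (auto simp: E_class_def A_def D_def intro: neg_def_uminus)

text \<open>
  \<open>P\<close> is the inverse of \<open>- D\<close> instead of \<open>D\<close>, so that both matrices are positive definite and \<open>Lop\<close> is a
  sum of two terms of the same sign.
\<close>
definition A' where "A' x = matrix_inv (A x)"
definition P where "P x = matrix_inv (- D x)"

lemma matrix_inv_D: "x \<in> I \<times> U \<Longrightarrow> matrix_inv (D x) = - P x"
  unfolding P_def by (intro matrix_inv_uminus invertible_pos_def pos_def_uminus_D)

lemma D_mul_inv: "x \<in> I \<times> U \<Longrightarrow> D x ** matrix_inv (D x) = mat 1"
  unfolding matrix_inv_D P_def by (intro matrix_mul_inv_uminus invertible_pos_def pos_def_uminus_D)

lemma smooth_A': "smooth_on (I \<times> U) (\<lambda>x. A' x $ i $ j)"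
  unfolding A'_def by (intro smooth_matrix_inv smooth_A invertible_pos_def pos_def_A)
lemma smooth_P: "smooth_on (I \<times> U) (\<lambda>x. P x $ i $ j)"
  unfolding P_def by (intro smooth_matrix_inv smooth_uminus_D invertible_pos_def pos_def_uminus_D)

lemma pos_def_A': "x \<in> I \<times> U \<Longrightarrow> pos_def (A' x)"
  and pos_def_P: "x \<in> I \<times> U \<Longrightarrow> pos_def (P x)"
  unfolding A'_def P_def by (intro pos_def_matrix_inv pos_def_A pos_def_uminus_D; assumption)+

definition Lop where
  "Lop f x = (\<Sum>a\<in>UNIV. \<Sum>b\<in>UNIV. A' x $ b $ a * cd (zdir a) (cd (zbdir b) f) x)
           + (\<Sum>a\<in>UNIV. \<Sum>b\<in>UNIV. P x $ b $ a * cd (wdir a) (cd (wbdir b) f) x)"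

definition Hop where "Hop f x = cd tdir f x - Lop f x"

text \<open>
  From here on the operator acts on functions of \<open>(t, p)\<close>, where all derivatives commute.
\<close>
lemma heat_op_eq_Hop:
  assumes f: "smooth_on (I \<times> U) f" and t: "t \<in> I" and p: "p \<in> U"
    and g: "\<And>s q. s \<in> I \<Longrightarrow> q \<in> U \<Longrightarrow> g s q = f (s, q)"
  shows "heat_op I u g t p = Hop f (t, p)"
proof -
  have 1: "dzbar b (g t) q = cd (zbdir b) f (t, q)" "dwbar c (g t) q = cd (wbdir c) f (t, q)"
    if "q \<in> U" for b c q
    by (rule wirtinger_slice[OF f t that g[OF t]]; assumption)+
  have "dz a (dzbar b (g t)) p = cd (zdir a) (cd (zbdir b) f) (t, p)" for a b
    by (rule wirtinger_slice[OF smooth_cd[OF f] t p 1(1)])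
  moreover have "dw a (dwbar b (g t)) p = cd (wdir a) (cd (wbdir b) f) (t, p)" for a b
    by (rule wirtinger_slice[OF smooth_cd[OF f] t p 1(2)])
  moreover have "dt I g t p = cd tdir f (t, p)"
    by (rule dt_eq_cd[where g = g, OF f t p g[OF _ p]])
  moreover have "matrix_inv (hess_ww (u t) p) = - P (t, p)"
    using matrix_inv_D[of "(t, p)"] t p by (simp add: D_def)
  ultimately show ?thesis
    by (simp add: heat_op_def L_op_def Hop_def Lop_def A'_def A_def sum_negf)
qed

section \<open>Linearisation of the flow\<close>

lemma cd_hessian:
  assumes x: "x \<in> I \<times> U"
  shows "cd c (\<lambda>x. A x $ i $ j) x = cd (zdir i) (cd (zbdir j) (cd c uc)) x"
    and "cd c (\<lambda>x. D x $ a $ b) x = cd (wdir a) (cd (wbdir b) (cd c uc)) x"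
proof -
  have "cd c (\<lambda>x. A x $ i $ j) x = cd c (cd (zdir i) (cd (zbdir j) uc)) x"
    by (rule cd_cong[OF hessian_slice(1) x])
  also have "\<dots> = cd (zdir i) (cd (zbdir j) (cd c uc)) x" by (rule cd_rotate[OF smooth_uc x])
  finally show "cd c (\<lambda>x. A x $ i $ j) x = cd (zdir i) (cd (zbdir j) (cd c uc)) x" .
  have "cd c (\<lambda>x. D x $ a $ b) x = cd c (cd (wdir a) (cd (wbdir b) uc)) x"
    by (rule cd_cong[OF hessian_slice(3) x])
  also have "\<dots> = cd (wdir a) (cd (wbdir b) (cd c uc)) x" by (rule cd_rotate[OF smooth_uc x])
  finally show "cd c (\<lambda>x. D x $ a $ b) x = cd (wdir a) (cd (wbdir b) (cd c uc)) x" .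
qed

lemma cd_cd_hessian:
  assumes x: "x \<in> I \<times> U"
  shows "cd c (cd d (\<lambda>x. A x $ i $ j)) x = cd (zdir i) (cd (zbdir j) (cd c (cd d uc))) x"
    and "cd c (cd d (\<lambda>x. D x $ a $ b)) x = cd (wdir a) (cd (wbdir b) (cd c (cd d uc))) x"
proof -
  have "cd c (cd d (\<lambda>x. A x $ i $ j)) x = cd c (cd (zdir i) (cd (zbdir j) (cd d uc))) x"
    by (rule cd_cong[OF cd_hessian(1) x])
  also have "\<dots> = cd (zdir i) (cd (zbdir j) (cd c (cd d uc))) x" by (rule cd_rotate[OF smooth_cd[OF smooth_uc] x])
  finally show "cd c (cd d (\<lambda>x. A x $ i $ j)) x = cd (zdir i) (cd (zbdir j) (cd c (cd d uc))) x" .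
  have "cd c (cd d (\<lambda>x. D x $ a $ b)) x = cd c (cd (wdir a) (cd (wbdir b) (cd d uc))) x"
    by (rule cd_cong[OF cd_hessian(2) x])
  also have "\<dots> = cd (wdir a) (cd (wbdir b) (cd c (cd d uc))) x" by (rule cd_rotate[OF smooth_cd[OF smooth_uc] x])
  finally show "cd c (cd d (\<lambda>x. D x $ a $ b)) x = cd (wdir a) (cd (wbdir b) (cd c (cd d uc))) x" .
qed

lemma Lop_trace:
  assumes "\<And>i j. cd (zdir j) (cd (zbdir i) f) x = FA j i"
    and "\<And>a b. cd (wdir b) (cd (wbdir a) f) x = FD b a"
  shows "Lop f x = (\<Sum>i\<in>UNIV. \<Sum>j\<in>UNIV. A' x $ i $ j * FA j i) + (\<Sum>i\<in>UNIV. \<Sum>j\<in>UNIV. P x $ i $ j * FD j i)"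
  unfolding Lop_def assms by (intro arg_cong2[where f = "(+)"] sum.swap)

lemma cd_tdir_uc:
  assumes x: "x \<in> I \<times> U"
  shows "cd tdir uc x = complex_of_real (dt I u (fst x) (snd x))"
proof -
  obtain t p where tp: "x = (t, p)" "t \<in> I" "p \<in> U" using x by auto
  have "dt I u t p = pd (1, 0) (\<lambda>(t, p). u t p) (t, p)"
    by (rule dt_slice[where g = u, OF smooth_u tp(2,3)]) simp
  moreover have "pd (1, 0) uc x = complex_of_real (pd (1, 0) (\<lambda>(t, p). u t p) x)"
    using pd_bounded_linear[OF bounded_linear_of_real smooth_u x, of "(1, 0)"]
    by (simp add: uc_def[abs_def] case_prod_beta)
  moreover have "pd 0 uc x = 0" by (rule linear_0[OF linear_pd[OF smooth_uc x]])
  ultimately show ?thesis by (simp add: cd_def tdir_def tp(1))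
qed

lemma flow_equation:
  assumes x: "x \<in> I \<times> U"
  shows "cd tdir uc x = complex_of_real (ln (Re (det (A x)))) - complex_of_real (ln (Re (det (- D x))))"
  using x flow by (auto simp: cd_tdir_uc A_def D_def)

lemma cd_uminus_D: "x \<in> I \<times> U \<Longrightarrow> cd c (\<lambda>x. (- D x) $ i $ j) x = - cd c (\<lambda>x. D x $ i $ j) x"
  using cd_minus[OF smooth_D] by simp

text \<open>
  The linearisation of \<open>log det A - log det (- D)\<close> is \<open>\<L>\<close>, because the entries of \<open>A\<close> and \<open>D\<close> are second
  derivatives of \<open>u\<close> and derivatives along fixed directions commute.
\<close>
lemma linearised_flow:
  assumes x: "x \<in> I \<times> U"
  shows "cd c (cd tdir uc) x = (\<Sum>i\<in>UNIV. \<Sum>j\<in>UNIV. A' x $ i $ j * cd c (\<lambda>x. A x $ j $ i) x)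
      - (\<Sum>i\<in>UNIV. \<Sum>j\<in>UNIV. P x $ i $ j * cd c (\<lambda>x. (- D x) $ j $ i) x)"
    and "cd c (cd tdir uc) x = Lop (cd c uc) x"
proof -
  have "cd c (cd tdir uc) x
      = cd c (\<lambda>x. complex_of_real (ln (Re (det (A x)))) - complex_of_real (ln (Re (det (- D x))))) x"
    by (rule cd_cong[OF flow_equation x])
  also have "\<dots> = cd c (\<lambda>x. complex_of_real (ln (Re (det (A x))))) x
      - cd c (\<lambda>x. complex_of_real (ln (Re (det (- D x))))) x"
    by (intro cd_diff smooth_ln_det smooth_A smooth_uminus_D pos_def_A pos_def_uminus_D x)
  also have "cd c (\<lambda>x. complex_of_real (ln (Re (det (A x))))) x
      = (\<Sum>i\<in>UNIV. \<Sum>j\<in>UNIV. A' x $ i $ j * cd c (\<lambda>x. A x $ j $ i) x)"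
    unfolding A'_def by (intro cd_ln_det smooth_A pos_def_A x)
  also have "cd c (\<lambda>x. complex_of_real (ln (Re (det (- D x))))) x
      = (\<Sum>i\<in>UNIV. \<Sum>j\<in>UNIV. P x $ i $ j * cd c (\<lambda>x. (- D x) $ j $ i) x)"
    unfolding P_def by (intro cd_ln_det smooth_uminus_D pos_def_uminus_D x)
  finally show *: "cd c (cd tdir uc) x = (\<Sum>i\<in>UNIV. \<Sum>j\<in>UNIV. A' x $ i $ j * cd c (\<lambda>x. A x $ j $ i) x)
      - (\<Sum>i\<in>UNIV. \<Sum>j\<in>UNIV. P x $ i $ j * cd c (\<lambda>x. (- D x) $ j $ i) x)" .
  show "cd c (cd tdir uc) x = Lop (cd c uc) x"
    unfolding * cd_uminus_D[OF x]
    using Lop_trace[OF cd_hessian(1)[OF x, symmetric] cd_hessian(2)[OF x, symmetric]]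
    by (simp add: sum_negf)
qed

lemma Hop_time_derivative: "x \<in> I \<times> U \<Longrightarrow> Hop (cd tdir uc) x = 0"
  by (simp add: Hop_def linearised_flow(2))

text \<open>
  The trace \<open>tr (M T N T\<^sup>*)\<close>.
\<close>
definition quad where
  "quad M N T = (\<Sum>a\<in>UNIV. \<Sum>b\<in>UNIV. M $ b $ a * (\<Sum>c\<in>UNIV. \<Sum>d\<in>UNIV. N $ c $ d * (T a c * cnj (T b d))))"

lemma cnj_hessian_derivative:
  assumes x: "x \<in> I \<times> U"
  shows "cd (dir_cnj c) (\<lambda>x. A x $ j $ i) x = cnj (cd c (\<lambda>x. A x $ i $ j) x)"
    and "cd (dir_cnj c) (\<lambda>x. D x $ b $ a) x = cnj (cd c (\<lambda>x. D x $ a $ b) x)"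
proof -
  have A: "A x $ j $ i = cnj (A x $ i $ j)" if "x \<in> I \<times> U" for x
    using pos_defD_cnj[OF pos_def_A[OF that]] by simp
  have D: "D x $ b $ a = cnj (D x $ a $ b)" if "x \<in> I \<times> U" for x
    using pos_defD_cnj[OF pos_def_uminus_D[OF that], of a b] by simp
  show "cd (dir_cnj c) (\<lambda>x. A x $ j $ i) x = cnj (cd c (\<lambda>x. A x $ i $ j) x)"
    using cd_cong[OF A x] cd_cnj[OF smooth_A x] by simp
  show "cd (dir_cnj c) (\<lambda>x. D x $ b $ a) x = cnj (cd c (\<lambda>x. D x $ a $ b) x)"
    using cd_cong[OF D x] cd_cnj[OF smooth_D x] by simp
qed

text \<open>
  Differentiating the linearised equation once more: the terms with second derivatives of \<open>A\<close> and \<open>D\<close>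
  form \<open>\<L>\<close> again and cancel, and the terms with squares of first derivatives remain.
\<close>
lemma Hop_levi:
  assumes x: "x \<in> I \<times> U"
  shows "Hop (cd c (cd (dir_cnj c) uc)) x
    = - quad (A' x) (A' x) (\<lambda>i j. cd c (\<lambda>x. A x $ i $ j) x) + quad (P x) (P x) (\<lambda>i j. cd c (\<lambda>x. D x $ i $ j) x)"
proof -
  let ?d = "dir_cnj c"
  have "cd tdir (cd c (cd ?d uc)) x = cd c (cd ?d (cd tdir uc)) x"
    by (rule cd_rotate[OF smooth_uc x])
  also have "\<dots> = cd c (\<lambda>x. (\<Sum>i\<in>UNIV. \<Sum>j\<in>UNIV. A' x $ i $ j * cd ?d (\<lambda>x. A x $ j $ i) x)
      - (\<Sum>i\<in>UNIV. \<Sum>j\<in>UNIV. P x $ i $ j * cd ?d (\<lambda>x. (- D x) $ j $ i) x)) x"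
    by (rule cd_cong[OF linearised_flow(1) x])
  also have "\<dots> = cd c (\<lambda>x. \<Sum>i\<in>UNIV. \<Sum>j\<in>UNIV. A' x $ i $ j * cd ?d (\<lambda>x. A x $ j $ i) x) x
      - cd c (\<lambda>x. \<Sum>i\<in>UNIV. \<Sum>j\<in>UNIV. P x $ i $ j * cd ?d (\<lambda>x. (- D x) $ j $ i) x) x"
    by (intro cd_diff smooth_sum smooth_mult smooth_cd smooth_A' smooth_P smooth_A smooth_uminus_D x)
  also have "cd c (\<lambda>x. \<Sum>i\<in>UNIV. \<Sum>j\<in>UNIV. A' x $ i $ j * cd ?d (\<lambda>x. A x $ j $ i) x) x
      = (\<Sum>i\<in>UNIV. \<Sum>j\<in>UNIV. A' x $ i $ j * cd c (cd ?d (\<lambda>x. A x $ j $ i)) x)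
        - quad (A' x) (A' x) (\<lambda>i j. cd c (\<lambda>x. A x $ i $ j) x)"
    unfolding A'_def quad_def cnj_hessian_derivative(1)[OF x, symmetric]
    by (intro cd_trace_inv smooth_A invertible_pos_def pos_def_A x)
  also have "cd c (\<lambda>x. \<Sum>i\<in>UNIV. \<Sum>j\<in>UNIV. P x $ i $ j * cd ?d (\<lambda>x. (- D x) $ j $ i) x) x
      = (\<Sum>i\<in>UNIV. \<Sum>j\<in>UNIV. P x $ i $ j * cd c (cd ?d (\<lambda>x. (- D x) $ j $ i)) x)
        - quad (P x) (P x) (\<lambda>i j. cd c (\<lambda>x. D x $ i $ j) x)"
  proof -
    have "cd c (\<lambda>x. (- D x) $ k $ l) x * cd ?d (\<lambda>x. (- D x) $ j $ i) x
        = cd c (\<lambda>x. D x $ k $ l) x * cnj (cd c (\<lambda>x. D x $ i $ j) x)" for i j k l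
      by (simp only: cd_uminus_D[OF x] cnj_hessian_derivative(2)[OF x, symmetric] minus_mult_minus)
    then show ?thesis
      unfolding P_def quad_def
      using cd_trace_inv[OF smooth_uminus_D invertible_pos_def[OF pos_def_uminus_D] x, of c ?d] by simp
  qed
  finally have evol: "cd tdir (cd c (cd ?d uc)) x
      = (\<Sum>i\<in>UNIV. \<Sum>j\<in>UNIV. A' x $ i $ j * cd c (cd ?d (\<lambda>x. A x $ j $ i)) x)
        - quad (A' x) (A' x) (\<lambda>i j. cd c (\<lambda>x. A x $ i $ j) x)
        - ((\<Sum>i\<in>UNIV. \<Sum>j\<in>UNIV. P x $ i $ j * cd c (cd ?d (\<lambda>x. (- D x) $ j $ i)) x)
        - quad (P x) (P x) (\<lambda>i j. cd c (\<lambda>x. D x $ i $ j) x))" .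
  have neg: "cd c (cd ?d (\<lambda>x. (- D x) $ j $ i)) x = - cd c (cd ?d (\<lambda>x. D x $ j $ i)) x" for i j
  proof -
    have "cd c (cd ?d (\<lambda>x. (- D x) $ j $ i)) x = cd c (\<lambda>x. - cd ?d (\<lambda>x. D x $ j $ i) x) x"
      by (rule cd_cong[OF cd_uminus_D x])
    also have "\<dots> = - cd c (cd ?d (\<lambda>x. D x $ j $ i)) x"
      by (rule cd_minus[OF smooth_cd[OF smooth_D] x])
    finally show ?thesis .
  qed
  have "Lop (cd c (cd ?d uc)) x
      = (\<Sum>i\<in>UNIV. \<Sum>j\<in>UNIV. A' x $ i $ j * cd c (cd ?d (\<lambda>x. A x $ j $ i)) x)
        + (\<Sum>i\<in>UNIV. \<Sum>j\<in>UNIV. P x $ i $ j * cd c (cd ?d (\<lambda>x. D x $ j $ i)) x)"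
    by (rule Lop_trace[OF cd_cd_hessian(1)[OF x, symmetric] cd_cd_hessian(2)[OF x, symmetric]])
  then show ?thesis
    unfolding Hop_def evol neg by (simp add: sum_negf)
qed

section \<open>The heat operator on the form of W\<close>

lemma Hop_cong:
  assumes "\<And>x. x \<in> I \<times> U \<Longrightarrow> f x = g x" "x \<in> I \<times> U"
  shows "Hop f x = Hop g x"
  unfolding Hop_def Lop_def using cd_cong[OF assms] cd_cong_fun[OF assms] by simp

lemma Hop_add:
  "smooth_on (I \<times> U) f \<Longrightarrow> smooth_on (I \<times> U) g \<Longrightarrow> x \<in> I \<times> U
    \<Longrightarrow> Hop (\<lambda>x. f x + g x) x = Hop f x + Hop g x"
  by (simp add: Hop_def Lop_def cd_add cd_cd_add algebra_simps sum.distrib)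

lemma Hop_const: "x \<in> I \<times> U \<Longrightarrow> Hop (\<lambda>x. k) x = 0"
  by (simp add: Hop_def Lop_def cd_const cd_cd_const)

lemma Hop_cmult:
  "smooth_on (I \<times> U) f \<Longrightarrow> x \<in> I \<times> U \<Longrightarrow> Hop (\<lambda>x. k * f x) x = k * Hop f x"
  by (simp add: Hop_def Lop_def cd_cmult cd_cd_cmult algebra_simps sum_distrib_left)

lemma Hop_sum:
  assumes "\<And>i. i \<in> X \<Longrightarrow> smooth_on (I \<times> U) (f i)" "x \<in> I \<times> U"
  shows "Hop (\<lambda>x. \<Sum>i\<in>X. f i x) x = (\<Sum>i\<in>X. Hop (f i) x)"
  using assms by (induction X rule: infinite_finite_induct) (simp_all add: Hop_const Hop_add smooth_sum)

lemma smooth_matrix_inv_D: "smooth_on (I \<times> U) (\<lambda>x. matrix_inv (D x) $ i $ j)"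
  by (rule smooth_on_cong[OF smooth_minus[OF smooth_P]]) (simp add: matrix_inv_D)

definition W where "W x = W_matrix (u (fst x)) (snd x)"

lemma W_block: "W x = block_matrix (A x - B x ** matrix_inv (D x) ** conj_transpose (B x))
    (B x ** matrix_inv (D x)) (matrix_inv (D x) ** conj_transpose (B x)) (- matrix_inv (D x))"
  by (simp add: W_def W_matrix_def Let_def A_def B_def D_def)

lemma smooth_W: "smooth_on (I \<times> U) (\<lambda>x. W x $ i $ j)"
  by (cases i; cases j; simp add: W_block block_matrix_def matrix_matrix_mult_def conj_transpose_def;
      intro smooth_diff smooth_minus smooth_sum smooth_mult smooth_cnj smooth_A smooth_B smooth_matrix_inv_D)

lemma heat_op_matrix_form:
  assumes "t \<in> I" "p \<in> U"
  shows "herm_form (heat_op_matrix I u (\<lambda>s. W_matrix (u s)) t p) v = Hop (\<lambda>x. herm_form (W x) v) (t, p)"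
proof -
  have x: "(t, p) \<in> I \<times> U" using assms by simp
  have "heat_op I u (\<lambda>s q. W_matrix (u s) q $ i $ j) t p = Hop (\<lambda>x. W x $ i $ j) (t, p)" for i j
    by (rule heat_op_eq_Hop[OF smooth_W assms]) (simp add: W_def)
  then have "herm_form (heat_op_matrix I u (\<lambda>s. W_matrix (u s)) t p) v
      = (\<Sum>i\<in>UNIV. \<Sum>j\<in>UNIV. (cnj (v $ i) * v $ j) * Hop (\<lambda>x. W x $ i $ j) (t, p))"
    by (simp add: herm_form_def heat_op_matrix_def ac_simps)
  also have "\<dots> = Hop (\<lambda>x. \<Sum>i\<in>UNIV. \<Sum>j\<in>UNIV. (cnj (v $ i) * v $ j) * W x $ i $ j) (t, p)"
    by (simp only: Hop_sum[OF _ x] Hop_cmult[OF smooth_W x] smooth_sum smooth_mult smooth_const smooth_W)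
  also have "(\<lambda>x. \<Sum>i\<in>UNIV. \<Sum>j\<in>UNIV. (cnj (v $ i) * v $ j) * W x $ i $ j) = (\<lambda>x. herm_form (W x) v)"
    by (simp add: herm_form_def ac_simps)
  finally show ?thesis .
qed

lemma cnj_cd_cd_uc:
  assumes x: "x \<in> I \<times> U"
  shows "cnj (cd c (cd d uc) x) = cd (dir_cnj c) (cd (dir_cnj d) uc) x"
proof -
  have 1: "cd (dir_cnj d) uc y = cnj (cd d uc y)" if "y \<in> I \<times> U" for y
  proof -
    have "(\<lambda>x. cnj (uc x)) = uc" by (simp add: uc_def fun_eq_iff)
    then show ?thesis using cd_cnj[OF smooth_uc that, of "dir_cnj d"] by simp
  qed
  have "cd (dir_cnj c) (cd (dir_cnj d) uc) x = cd (dir_cnj c) (\<lambda>y. cnj (cd d uc y)) x"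
    by (rule cd_cong[OF 1 x])
  then show ?thesis using cd_cnj[OF smooth_cd[OF smooth_uc] x] by simp
qed

text \<open>
  The direction \<open>\<Sum> cnj \<xi>\<^sub>a \<partial>/\<partial>z\<^sub>a - \<Sum> cnj c\<^sub>b \<partial>/\<partial>w\<^sub>b\<close>.  Its coefficients are constant, hence derivatives along
  it commute with all others.
\<close>
definition graph_dir where
  "graph_dir \<xi> c = (\<Sum>a\<in>UNIV. dir_scale (cnj (\<xi> $ a)) (zdir a)) + (\<Sum>b\<in>UNIV. dir_scale (- cnj (c $ b)) (wdir b))"

lemma cd_graph_dir:
  assumes "smooth_on (I \<times> U) f" "x \<in> I \<times> U"
  shows "cd (graph_dir \<xi> c) f x = (\<Sum>a\<in>UNIV. cnj (\<xi> $ a) * cd (zdir a) f x) - (\<Sum>b\<in>UNIV. cnj (c $ b) * cd (wdir b) f x)"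
    and "cd (dir_cnj (graph_dir \<xi> c)) f x = (\<Sum>a\<in>UNIV. \<xi> $ a * cd (zbdir a) f x) - (\<Sum>b\<in>UNIV. c $ b * cd (wbdir b) f x)"
  by (simp_all add: graph_dir_def dir_cnj_add dir_cnj_sum dir_cnj_scale cd_dir_add cd_dir_sum cd_dir_scale assms sum_negf)

lemma cd_graph_dir_uc:
  assumes x: "x \<in> I \<times> U"
  shows "cd (zdir i) (cd (dir_cnj (graph_dir \<xi> c)) uc) x = (A x *v \<xi> - B x *v c) $ i"
    and "cd (wdir a) (cd (dir_cnj (graph_dir \<xi> c)) uc) x = (conj_transpose (B x) *v \<xi> - D x *v c) $ a"
    and "cd (graph_dir \<xi> c) (cd (dir_cnj (graph_dir \<xi> c)) uc) x
      = cdot \<xi> (A x *v \<xi>) - cdot (conj_transpose (B x) *v \<xi>) c - cdot c (conj_transpose (B x) *v \<xi>) + cdot c (D x *v c)"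
proof -
  have expand: "cd e (cd (dir_cnj (graph_dir \<xi> c)) uc) x
      = (\<Sum>j\<in>UNIV. \<xi> $ j * cd e (cd (zbdir j) uc) x) - (\<Sum>b\<in>UNIV. c $ b * cd e (cd (wbdir b) uc) x)" for e
    using cd_graph_dir(2)[OF smooth_cd[OF smooth_uc] x, of \<xi> c e] cd_commute[OF smooth_uc x] by simp
  have B: "cd (wdir a) (cd (zbdir j) uc) x = cnj (B x $ j $ a)" for a j
    using cd_commute[OF smooth_uc x] cnj_cd_cd_uc[OF x] by (simp add: hessian_slice[OF x])
  show 1: "cd (zdir i) (cd (dir_cnj (graph_dir \<xi> c)) uc) x = (A x *v \<xi> - B x *v c) $ i" for i
    by (simp add: expand hessian_slice[OF x] matrix_vector_mult_def mult.commute)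
  show 2: "cd (wdir a) (cd (dir_cnj (graph_dir \<xi> c)) uc) x = (conj_transpose (B x) *v \<xi> - D x *v c) $ a" for a
    by (simp add: expand B hessian_slice(3)[OF x] conj_transpose_def matrix_vector_mult_def mult.commute)
  have "cd (graph_dir \<xi> c) (cd (dir_cnj (graph_dir \<xi> c)) uc) x
      = cdot \<xi> (A x *v \<xi> - B x *v c) - cdot c (conj_transpose (B x) *v \<xi> - D x *v c)"
    by (simp only: cd_graph_dir(1)[OF smooth_cd[OF smooth_uc] x] 1 2 cdot_def)
  then show "cd (graph_dir \<xi> c) (cd (dir_cnj (graph_dir \<xi> c)) uc) x
      = cdot \<xi> (A x *v \<xi>) - cdot (conj_transpose (B x) *v \<xi>) c - cdot c (conj_transpose (B x) *v \<xi>) + cdot c (D x *v c)"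
    by (simp add: cdot_diff_right cdot_mat_vec[of \<xi> "B x"])
qed

text \<open>
  The heat operator meets the three terms separately: the first one is governed by the flow, the
  second one is constant, and for a suitable \<open>c\<close> the third one vanishes to second order at a given point.
\<close>
lemma W_form_square:
  fixes v :: "complex^('k + 'l)" and c :: "complex^'l"
  defines "\<xi> \<equiv> \<chi> i. v $ Inl i" and "\<eta> \<equiv> \<chi> i. v $ Inr i"
  defines "r \<equiv> \<lambda>x. conj_transpose (B x) *v \<xi> - \<eta> - D x *v c"
  assumes x: "x \<in> I \<times> U"
  shows "herm_form (W x) v = cd (graph_dir \<xi> c) (cd (dir_cnj (graph_dir \<xi> c)) uc) x + (cdot \<eta> c + cdot c \<eta>)
    + (\<Sum>a\<in>UNIV. \<Sum>b\<in>UNIV. P x $ a $ b * (cnj (r x $ a) * r x $ b))"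
proof -
  let ?y = "conj_transpose (B x) *v \<xi> - \<eta>"
  have herm: "hermitian (D x)" using u_class x by (auto simp: E_class_def neg_def_def D_def)
  have sq: "cdot ?y (matrix_inv (D x) *v ?y)
      = cdot ?y c + cdot c ?y - cdot c (D x *v c) + cdot (r x) (matrix_inv (D x) *v r x)"
    unfolding r_def by (rule complete_square[OF herm D_mul_inv[OF x]])
  have "cdot (r x) (matrix_inv (D x) *v r x) = - (\<Sum>a\<in>UNIV. \<Sum>b\<in>UNIV. P x $ a $ b * (cnj (r x $ a) * r x $ b))"
    by (simp add: matrix_inv_D[OF x] cdot_def matrix_vector_mult_def sum_negf sum_distrib_left mult.left_commute)
  then show ?thesis
    unfolding W_block block_matrix_form \<xi>_def[symmetric] \<eta>_def[symmetric] sq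
    by (simp add: cd_graph_dir_uc(3)[OF x] cdot_diff_left cdot_diff_right)
qed

lemma quad_nonneg: "pos_def M \<Longrightarrow> pos_def N \<Longrightarrow> quad M N T \<in> \<real>\<^sub>\<ge>\<^sub>0"
  unfolding quad_def by (rule pos_def_contraction_nonneg)

lemma quad_transpose:
  "quad (transpose M) N T = (\<Sum>a\<in>UNIV. \<Sum>b\<in>UNIV. M $ b $ a * (\<Sum>c\<in>UNIV. \<Sum>d\<in>UNIV. N $ c $ d * (T b c * cnj (T a d))))"
  unfolding quad_def transpose_def by (subst sum.swap) simp

text \<open>
  As \<open>r\<close> vanishes at \<open>x\<close>, the product rule leaves for \<open>\<partial>\<^sub>a \<partial>'\<^sub>b\<close>, with \<open>\<partial>'\<close> the conjugate derivative, only
  the products \<open>\<partial>\<^sub>a r\<^sup>* P \<partial>'\<^sub>b r\<close> and \<open>\<partial>'\<^sub>b r\<^sup>* P \<partial>\<^sub>a r\<close>.  In the second one \<open>a\<close> and \<open>b\<close> have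
  changed places, hence the transposes.
\<close>
lemma Hop_vanishing_form:
  assumes r: "\<And>a. smooth_on (I \<times> U) (\<lambda>x. r x $ a)" and x: "x \<in> I \<times> U" and zero: "r x = 0"
  shows "Hop (\<lambda>x. \<Sum>a\<in>UNIV. \<Sum>b\<in>UNIV. P x $ a $ b * (cnj (r x $ a) * r x $ b)) x
    = - (quad (A' x) (P x) (\<lambda>a c. cd (zdir a) (\<lambda>x. cnj (r x $ c)) x)
       + quad (transpose (A' x)) (P x) (\<lambda>a c. cd (zbdir a) (\<lambda>x. cnj (r x $ c)) x)
       + quad (P x) (P x) (\<lambda>a c. cd (wdir a) (\<lambda>x. cnj (r x $ c)) x)
       + quad (transpose (P x)) (P x) (\<lambda>a c. cd (wbdir a) (\<lambda>x. cnj (r x $ c)) x))"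
proof -
  have r': "cd e (\<lambda>x. r x $ a) x = cnj (cd (dir_cnj e) (\<lambda>x. cnj (r x $ a)) x)" for e a
    using cd_cnj[OF smooth_cnj[OF r] x, of e a] by simp
  note sm = smooth_sum smooth_mult smooth_P smooth_cnj r
  have t: "cd tdir (\<lambda>x. \<Sum>a\<in>UNIV. \<Sum>b\<in>UNIV. P x $ a $ b * (cnj (r x $ a) * r x $ b)) x = 0"
    by (simp add: cd_sum sm x cd_mult_vanish zero)
  have dd: "cd e (cd d (\<lambda>x. \<Sum>a\<in>UNIV. \<Sum>b\<in>UNIV. P x $ a $ b * (cnj (r x $ a) * r x $ b))) x
      = (\<Sum>a\<in>UNIV. \<Sum>b\<in>UNIV. P x $ a $ b *
          (cd e (\<lambda>x. cnj (r x $ a)) x * cnj (cd (dir_cnj d) (\<lambda>x. cnj (r x $ b)) x)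
           + cd d (\<lambda>x. cnj (r x $ a)) x * cnj (cd (dir_cnj e) (\<lambda>x. cnj (r x $ b)) x)))" for e d
    by (simp add: cd_cd_sum sm x cd_cd_mult_vanish zero r')
  show ?thesis
    unfolding Hop_def t Lop_def dd dir_cnj_dir_cnj quad_transpose unfolding quad_def
    by (simp add: distrib_left sum.distrib)
qed

text \<open>
  With \<open>c = D\<^sup>-\<^sup>1 y\<close> frozen at the given point, the wrongly signed term of \<open>Hop_levi\<close> cancels against one
  of the terms of \<open>Hop_vanishing_form\<close>.
\<close>
lemma heat_op_matrix_neg_semidef:
  assumes "t \<in> I" "p \<in> U"
  shows "neg_semidef (heat_op_matrix I u (\<lambda>s. W_matrix (u s)) t p)"
proof (rule neg_semidefI)
  fix v :: "complex^('k + 'l)"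
  define x0 where "x0 = (t, p)"
  have x0: "x0 \<in> I \<times> U" using assms by (simp add: x0_def)
  define \<xi> :: "complex^'k" where "\<xi> = (\<chi> i. v $ Inl i)"
  define \<eta> :: "complex^'l" where "\<eta> = (\<chi> i. v $ Inr i)"
  \<comment> \<open>constant, equal to \<open>D\<^sup>-\<^sup>1 y\<close> only at \<open>x0\<close>\<close>
  define c where "c = matrix_inv (D x0) *v (conj_transpose (B x0) *v \<xi> - \<eta>)"
  define Z where "Z = graph_dir \<xi> c"
  define r where "r x = conj_transpose (B x) *v \<xi> - \<eta> - D x *v c" for x
  have r: "r x $ a = cd (wdir a) (cd (dir_cnj Z) uc) x - \<eta> $ a" if "x \<in> I \<times> U" for x a
    using cd_graph_dir_uc(2)[OF that] by (simp add: r_def Z_def)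
  have smooth_r: "smooth_on (I \<times> U) (\<lambda>x. r x $ a)" for a
    by (rule smooth_on_cong[OF smooth_diff[OF smooth_cd[OF smooth_cd[OF smooth_uc]] smooth_const] r])
  have r0: "r x0 = 0" by (simp add: r_def c_def matrix_vector_mul_assoc D_mul_inv[OF x0])
  \<comment> \<open>this identity makes the two terms formed with \<open>Z D\<close> cancel\<close>
  have wr: "cd (wdir a) (\<lambda>x. cnj (r x $ b)) x0 = cd Z (\<lambda>x. D x $ a $ b) x0" for a b
  proof -
    have "cnj (r x $ b) = cd (wbdir b) (cd Z uc) x - cnj (\<eta> $ b)" if "x \<in> I \<times> U" for x
      by (simp add: r[OF that] cnj_cd_cd_uc[OF that])
    then have "cd (wdir a) (\<lambda>x. cnj (r x $ b)) x0 = cd (wdir a) (\<lambda>x. cd (wbdir b) (cd Z uc) x - cnj (\<eta> $ b)) x0"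
      by (rule cd_cong[OF _ x0])
    also have "\<dots> = cd (wdir a) (cd (wbdir b) (cd Z uc)) x0"
      by (simp add: cd_diff smooth_cd smooth_uc smooth_const cd_const x0)
    finally show ?thesis by (simp add: cd_hessian(2)[OF x0])
  qed
  let ?R = "\<lambda>x. \<Sum>a\<in>UNIV. \<Sum>b\<in>UNIV. P x $ a $ b * (cnj (r x $ a) * r x $ b)"
  have "Hop (\<lambda>x. herm_form (W x) v) x0
      = Hop (\<lambda>x. cd Z (cd (dir_cnj Z) uc) x + (cdot \<eta> c + cdot c \<eta>) + ?R x) x0"
    unfolding Z_def r_def \<xi>_def \<eta>_def by (intro Hop_cong[OF _ x0] W_form_square)
  also have "\<dots> = Hop (cd Z (cd (dir_cnj Z) uc)) x0 + Hop ?R x0"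
    by (simp add: Hop_add Hop_const smooth_add smooth_const smooth_cd smooth_uc smooth_sum smooth_mult
        smooth_P smooth_cnj smooth_r x0)
  finally have form: "- Hop (\<lambda>x. herm_form (W x) v) x0
      = quad (A' x0) (A' x0) (\<lambda>i j. cd Z (\<lambda>x. A x $ i $ j) x0)
       + quad (A' x0) (P x0) (\<lambda>a c. cd (zdir a) (\<lambda>x. cnj (r x $ c)) x0)
       + quad (transpose (A' x0)) (P x0) (\<lambda>a c. cd (zbdir a) (\<lambda>x. cnj (r x $ c)) x0)
       + quad (transpose (P x0)) (P x0) (\<lambda>a c. cd (wbdir a) (\<lambda>x. cnj (r x $ c)) x0)"
    by (simp add: Hop_levi[OF x0] Hop_vanishing_form[OF smooth_r x0 r0] wr)
  have "- Hop (\<lambda>x. herm_form (W x) v) x0 \<in> \<real>\<^sub>\<ge>\<^sub>0"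
    unfolding form by (intro nonneg_Reals_add_I quad_nonneg pos_def_transpose pos_def_A' pos_def_P x0)
  then show "- herm_form (heat_op_matrix I u (\<lambda>s. W_matrix (u s)) t p) v \<in> \<real>\<^sub>\<ge>\<^sub>0"
    by (simp add: heat_op_matrix_form[OF assms] x0_def)
qed

lemma heat_op_time_derivative:
  assumes "t \<in> I" "p \<in> U"
  shows "heat_op I u (\<lambda>s q. complex_of_real (dt I u s q)) t p = 0"
proof -
  have "heat_op I u (\<lambda>s q. complex_of_real (dt I u s q)) t p = Hop (cd tdir uc) (t, p)"
    by (rule heat_op_eq_Hop[OF smooth_cd[OF smooth_uc] assms]) (simp add: cd_tdir_uc)
  then show ?thesis using assms by (simp add: Hop_time_derivative)
qed

end

theorem proposition3p3:
  fixes U :: "((complex^'k) \<times> (complex^'l)) set"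
    and I :: "real set"
    and u :: "real \<Rightarrow> (complex^'k) \<times> (complex^'l) \<Rightarrow> real"
  assumes "open U"
    and "is_interval I" and "interior I \<noteq> {}"
    and "smooth_on (I \<times> U) (\<lambda>(t, p). u t p)"
    and "\<And>t. t \<in> I \<Longrightarrow> u t \<in> E_class U"
    and "\<And>t p. t \<in> I \<Longrightarrow> p \<in> U \<Longrightarrow>
           dt I u t p = ln (Re (det (hess_zz (u t) p))) - ln (Re (det (- hess_ww (u t) p)))"
  shows "(\<forall>t\<in>I. \<forall>p\<in>U. heat_op I u (\<lambda>s q. complex_of_real (dt I u s q)) t p = 0) \<and>
         (\<forall>t\<in>I. \<forall>p\<in>U. neg_semidef (heat_op_matrix I u (\<lambda>s. W_matrix (u s)) t p))"
proof -
  interpret mixed_flow U I u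
    using assms by unfold_locales
  show ?thesis using heat_op_time_derivative heat_op_matrix_neg_semidef by blast
qed

end
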